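(* Let $p\in(0,\infty)$ and let $\omega$ be a weight on $\mathbb{R}^n$. A subset $\mathcal{F}$ of $L^p_\omega(\mathbb{R}^n)$ is relatively compact (equivalently, totally bounded) if the following statements are valid: (a) $\mathcal{F}$ is bounded, i.e. $\sup_{f\in\mathcal{F}}\|f\|_{L^p_\omega(\mathbb{R}^n)}<\infty$; (b) $\mathcal{F}$ uniformly vanishes at infinity, that is, $\lim_{N\to\infty}\sup_{f\in\mathcal{F}}\|f\chi_{B^c(0,N)}\|_{L^p_\omega(\mathbb{R}^n)}=0$; (c) $\mathcal{F}$ is equicontinuous, that is, $\lim_{r\to0}\sup_{f\in\mathcal{F}}\sup_{y\in B(0,r)}\|\tau_yf-f\|_{L^p_\omega(\mathbb{R}^n)}=0$.
   Context: A weight is a nonnegative locally integrable function on $\mathbb{R}^n$ taking values in $(0,\infty)$ almost everywhere. $L^p_\omega(\mathbb{R}^n)$ is the space of Lebesgue measurable, a.e. finite functions $f$ on $\mathbb{R}^n$ (functions equal a.e. are identified) with $$\|f\|_{L^p_\omega(\mathbb{R}^n)}:=\left(\int_{\mathbb{R}^n}|f(x)|^p\omega(x)\,dx\right)^{1/p}<\infty,$$ which is a norm for $p\ge1$ and a quasi-norm for $0<p<1$. $B(0,r)$ is the open Euclidean ball of radius $r$ centered at $0$, $B^c(0,N)=\mathbb{R}^n\setminus B(0,N)$, $\chi_A$ is the indicator function of $A$, and $\tau_yf(x)=f(x-y)$. *)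

theory Defs
  imports "HOL-Analysis.Analysis"
begin

(* Weights are [0,\<infinity>]-valued: they are required to be positive and finite only almost everywhere. *)
definition weight :: "(real ^ 'n \<Rightarrow> ennreal) \<Rightarrow> bool" where
  "weight \<omega> \<longleftrightarrow>
     \<omega> \<in> borel_measurable lebesgue \<and>
     (\<forall>K. compact K \<longrightarrow> (\<integral>\<^sup>+x\<in>K. \<omega> x \<partial>lebesgue) < \<infinity>) \<and>
     (AE x in lebesgue. 0 < \<omega> x \<and> \<omega> x < \<infinity>)"

(* Only used with a positive exponent r. *)
definition ennreal_powr :: "ennreal \<Rightarrow> real \<Rightarrow> ennreal" where
  "ennreal_powr a r = (if a = \<infinity> then \<infinity> else ennreal (enn2real a powr r))"

text \<open>
  The class \<open>{real_normed_field, euclidean_space}\<close> of scalars has, up to isomorphism, only the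
  members \<open>\<real>\<close> and \<open>\<complex>\<close>.  The (quasi-)norm takes the value \<open>\<infinity>\<close> on functions outside the space,
  so that it can be applied to differences of a function and its translates.
\<close>

definition Lp_norm ::
    "real \<Rightarrow> (real ^ 'n \<Rightarrow> ennreal) \<Rightarrow> (real ^ 'n \<Rightarrow> 'b::{real_normed_field, euclidean_space}) \<Rightarrow> ennreal"
  where "Lp_norm p \<omega> f =
    ennreal_powr (\<integral>\<^sup>+x. ennreal (norm (f x) powr p) * \<omega> x \<partial>lebesgue) (1 / p)"

definition Lp_functions ::
    "real \<Rightarrow> (real ^ 'n \<Rightarrow> ennreal) \<Rightarrow> (real ^ 'n \<Rightarrow> 'b::{real_normed_field, euclidean_space}) set"
  where "Lp_functions p \<omega> = {f \<in> borel_measurable lebesgue. Lp_norm p \<omega> f < \<infinity>}"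

definition ae_class ::
    "(real ^ 'n \<Rightarrow> 'b::{real_normed_field, euclidean_space}) \<Rightarrow> (real ^ 'n \<Rightarrow> 'b) set"
  where "ae_class f = {g \<in> borel_measurable lebesgue. AE x in lebesgue. g x = f x}"

definition Lp_space ::
    "real \<Rightarrow> (real ^ 'n \<Rightarrow> ennreal) \<Rightarrow> (real ^ 'n \<Rightarrow> 'b::{real_normed_field, euclidean_space}) set set"
  where "Lp_space p \<omega> = ae_class ` Lp_functions p \<omega>"

definition Lp_ball ::
    "real \<Rightarrow> (real ^ 'n \<Rightarrow> ennreal) \<Rightarrow> (real ^ 'n \<Rightarrow> 'b::{real_normed_field, euclidean_space}) \<Rightarrow> real
      \<Rightarrow> (real ^ 'n \<Rightarrow> 'b) set set"
  where "Lp_ball p \<omega> f \<epsilon> =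
    ae_class ` {g \<in> Lp_functions p \<omega>. Lp_norm p \<omega> (\<lambda>x. g x - f x) < ennreal \<epsilon>}"

(* For p < 1 the quasi-norm does not satisfy the triangle inequality, so it does not itself
   define a metric; the topology is the one whose neighbourhoods contain quasi-norm balls. *)
definition Lp_open ::
    "real \<Rightarrow> (real ^ 'n \<Rightarrow> ennreal) \<Rightarrow> (real ^ 'n \<Rightarrow> 'b::{real_normed_field, euclidean_space}) set set \<Rightarrow> bool"
  where "Lp_open p \<omega> U \<longleftrightarrow> U \<subseteq> Lp_space p \<omega> \<and>
    (\<forall>f \<in> Lp_functions p \<omega>. ae_class f \<in> U \<longrightarrow> (\<exists>\<epsilon>>0. Lp_ball p \<omega> f \<epsilon> \<subseteq> U))"

definition Lp_topology ::
    "real \<Rightarrow> (real ^ 'n \<Rightarrow> ennreal) \<Rightarrow> (real ^ 'n \<Rightarrow> 'b::{real_normed_field, euclidean_space}) set topology"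
  where "Lp_topology p \<omega> = topology (Lp_open p \<omega>)"

lemma Lp_ball_mono: "\<delta> \<le> \<epsilon> \<Longrightarrow> Lp_ball p \<omega> f \<delta> \<subseteq> Lp_ball p \<omega> f \<epsilon>"
  unfolding Lp_ball_def by (intro image_mono Collect_mono) (auto intro: order_less_le_trans ennreal_leI)

lemma istopology_Lp_open:
  fixes \<omega> :: "real ^ 'n \<Rightarrow> ennreal"
  shows "istopology (Lp_open p \<omega> :: (real ^ 'n \<Rightarrow> 'b::{real_normed_field, euclidean_space}) set set \<Rightarrow> bool)"
  unfolding istopology_def
proof (intro conjI allI impI)
  fix S T :: "(real ^ 'n \<Rightarrow> 'b) set set"
  assume S: "Lp_open p \<omega> S" and T: "Lp_open p \<omega> T"
  have "\<exists>\<epsilon>>0. Lp_ball p \<omega> f \<epsilon> \<subseteq> S \<inter> T"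
    if f: "f \<in> Lp_functions p \<omega>" "ae_class f \<in> S \<inter> T" for f
  proof -
    obtain a b where ab: "a > 0" "Lp_ball p \<omega> f a \<subseteq> S" "b > 0" "Lp_ball p \<omega> f b \<subseteq> T"
      using S T f unfolding Lp_open_def by blast
    have "Lp_ball p \<omega> f (min a b) \<subseteq> S \<inter> T"
      using ab Lp_ball_mono[of "min a b" a p \<omega> f] Lp_ball_mono[of "min a b" b p \<omega> f] by auto
    with ab show ?thesis by (intro exI[of _ "min a b"]) auto
  qed
  with S T show "Lp_open p \<omega> (S \<inter> T)"
    unfolding Lp_open_def by blast
next
  fix K :: "(real ^ 'n \<Rightarrow> 'b) set set set"
  assume K: "\<forall>S\<in>K. Lp_open p \<omega> S"
  then have "\<exists>\<epsilon>>0. Lp_ball p \<omega> f \<epsilon> \<subseteq> \<Union> K"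
    if "f \<in> Lp_functions p \<omega>" "ae_class f \<in> \<Union> K" for f
    using that unfolding Lp_open_def by (meson Union_iff Union_upper order_trans)
  with K show "Lp_open p \<omega> (\<Union> K)"
    unfolding Lp_open_def by blast
qed

lemma openin_Lp_topology: "openin (Lp_topology p \<omega>) = Lp_open p \<omega>"
  unfolding Lp_topology_def by (rule topology_inverse'[OF istopology_Lp_open])

lemma topspace_Lp_topology: "topspace (Lp_topology p \<omega>) = Lp_space p \<omega>"
proof
  show "topspace (Lp_topology p \<omega>) \<subseteq> Lp_space p \<omega>"
    unfolding topspace_def openin_Lp_topology Lp_open_def by blast
  have "Lp_open p \<omega> (Lp_space p \<omega>)"
    unfolding Lp_open_def Lp_ball_def Lp_space_def by (auto intro!: exI[of _ 1])
  then show "Lp_space p \<omega> \<subseteq> topspace (Lp_topology p \<omega>)"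
    unfolding topspace_def openin_Lp_topology by blast
qed

definition relatively_compact_in :: "'a topology \<Rightarrow> 'a set \<Rightarrow> bool" where
  "relatively_compact_in X S \<longleftrightarrow> S \<subseteq> topspace X \<and> compactin X (X closure_of S)"

definition Lp_totally_bounded ::
    "real \<Rightarrow> (real ^ 'n \<Rightarrow> ennreal) \<Rightarrow> (real ^ 'n \<Rightarrow> 'b::{real_normed_field, euclidean_space}) set \<Rightarrow> bool"
  where "Lp_totally_bounded p \<omega> F \<longleftrightarrow>
    (\<forall>\<epsilon>>0. \<exists>K. finite K \<and> K \<subseteq> F \<and> ae_class ` F \<subseteq> (\<Union>f\<in>K. Lp_ball p \<omega> f \<epsilon>))"

end

theory Submission
  imports Defs
begin

text \<open>
  Averaging the equicontinuity condition over all shifts \<open>y\<close> in a small cube and applying Tonelli gives, for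
  the cells \<open>Q\<close> of a fine grid, a small value of the sum over \<open>Q\<close> of
  \<open>|Q|\<^sup>-\<^sup>1 \<integral>\<^sub>Q \<integral>\<^sub>Q |f z - f x|\<^sup>p \<omega> x dx dz\<close>.  So each \<open>Q\<close> contains a point \<open>z\<close> with
  \<open>\<integral>\<^sub>Q |f z - f x|\<^sup>p \<omega> x dx\<close> at most this average, and \<open>f\<close> is close to a step function, uniformly
  over the family.  Mollification, which needs local integrability of \<open>f\<close>, is thereby avoided.  Boundedness
  of the family bounds the coefficients of the step functions, whence finite nets.  The topology is
  induced by the metric \<open>(\<integral> |f - g|\<^sup>p \<omega>) powr (1 / max 1 p)\<close>, which is complete, so total
  boundedness gives a compact closure.
\<close>

subsection \<open>Inequalities and completeness for powers of the norm\<close>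

text \<open>For p < 1 a function of the space need not be locally integrable, and for p \<ge> 1
  membership alone does not make it so, because negative powers of \<omega> are not controlled. The
  coefficients of the step functions are therefore values \<open>f (z k)\<close> at well chosen
  points rather than means. The points depend on f, the cells do not, and this is all that
  compactness in finitely many coefficients requires.

  In the double integral \<omega> stays at x and only f is shifted, so \<omega> is never compared
  with its translates. The price of passing from cells to shifts is the factor 2^n, the volume of
  the difference set of a cell divided by the volume of the cell.

  Estimates are made for the p-th power of the norm, whose triangle inequality with constant
  \<open>2 powr p\<close> treats all p > 0 alike. Tonelli requires measurability on a product of
  Borel spaces, which Lebesgue measurable f and \<omega> do not provide; both are first replaced by
  Borel representatives.\<close>

lemma powr_add_le_add_powr:
  fixes a b \<theta> :: real
  assumes "0 \<le> a" "0 \<le> b" "0 < \<theta>" "\<theta> \<le> 1"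
  shows "(a + b) powr \<theta> \<le> a powr \<theta> + b powr \<theta>"
proof (cases "a + b = 0")
  case True
  with assms show ?thesis by auto
next
  case False
  define s where "s = a + b"
  have s: "0 < s" using False assms by (simp add: s_def)
  \<comment> \<open>By homogeneity it suffices to treat the fractions \<open>a / s\<close> and
    \<open>b / s\<close>, which lie in [0,1], where lowering the exponent from 1 to \<theta>
    increases a power.\<close>
  have *: "c / s \<le> (c / s) powr \<theta>" if "0 \<le> c" "c \<le> s" for c
    using powr_mono'[of \<theta> 1 "c / s"] that s assms by simp
  have "1 = a / s + b / s" using s by (simp add: s_def flip: add_divide_distrib)
  also have "\<dots> \<le> (a / s) powr \<theta> + (b / s) powr \<theta>"
    using assms by (intro add_mono *) (auto simp: s_def)
  also have "\<dots> = (a powr \<theta> + b powr \<theta>) / s powr \<theta>"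
    using assms s by (simp add: powr_divide add_divide_distrib)
  finally show ?thesis using s by (simp add: field_simps s_def)
qed

lemma powr_add_le_two_powr:
  fixes a b p :: real
  assumes "0 \<le> a" "0 \<le> b" "0 < p"
  shows "(a + b) powr p \<le> 2 powr p * (a powr p + b powr p)"
proof -
  have "(a + b) powr p \<le> (2 * max a b) powr p"
    using assms by (intro powr_mono2) auto
  also have "\<dots> = 2 powr p * (max a b) powr p"
    using assms by (simp add: powr_mult)
  also have "\<dots> \<le> 2 powr p * (a powr p + b powr p)"
    by (intro mult_left_mono) (auto simp: max_def)
  finally show ?thesis .
qed

text \<open>The endpoint 0 has to be included because norms vanish. If one argument is 0, the
  inequality reduces to \<open>u powr q \<le> u\<close> for u in (0,1); positive pairs fall under
  \<open>powr_convex\<close>.\<close>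

lemma convex_on_powr_nonneg:
  fixes q :: real
  assumes "1 \<le> q"
  shows "convex_on {0..} (\<lambda>x. x powr q)"
proof (rule convex_onI)
  fix t x y :: real
  assume t: "0 < t" "t < 1" and xy: "x \<in> {0..}" "y \<in> {0..}"
  have scale: "(u * z) powr q \<le> u * z powr q" if "0 < u" "u < 1" "0 \<le> z" for u z :: real
  proof -
    have "u powr q \<le> u" using powr_mono'[of 1 q u] that assms by simp
    then show ?thesis using that by (simp add: powr_mult mult_right_mono)
  qed
  consider "x = 0" | "y = 0" | "0 < x" "0 < y" using xy by fastforce
  then show "((1 - t) *\<^sub>R x + t *\<^sub>R y) powr q \<le> (1 - t) * x powr q + t * y powr q"
  proof cases
    case 1
    then show ?thesis using scale[of t y] t xy assms by simp
  next
    case 2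
    then show ?thesis using scale[of "1 - t" x] t xy assms by simp
  next
    case 3
    then show ?thesis
      using convex_onD[OF powr_convex[OF assms], of t x y] t by simp
  qed
qed simp

text \<open>The root is left out, so that values in [0,\<infinity>] can be added and integrated
  freely; the measure is arbitrary, so that the weight enters only through
  \<open>density lebesgue \<omega>\<close>.\<close>

definition Lp_mod :: "real \<Rightarrow> 'a measure \<Rightarrow> ('a \<Rightarrow> 'b::real_normed_vector) \<Rightarrow> ennreal" where
  "Lp_mod p M f = (\<integral>\<^sup>+x. ennreal (norm (f x) powr p) \<partial>M)"

text \<open>A pointwise Minkowski inequality for all p > 0. With \<open>\<theta> = min 1 p\<close>
  the power \<open>norm x powr \<theta>\<close> is subadditive, and \<theta> * q = p leaves a convex
  power q. The weights \<open>s / (s + t)\<close> and \<open>t / (s + t)\<close> are those for which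
  the right side integrates to \<open>(s + t) powr q\<close> when the two integrals are
  \<open>s powr q\<close> and \<open>t powr q\<close>.\<close>

lemma norm_add_powr_le_weighted:
  fixes x y :: "'b::real_normed_vector"
  assumes p: "0 < p" and st: "0 < s" "0 < t" and q: "q = max 1 p"
  shows "norm (x + y) powr p \<le>
    (s + t) powr q * (s / (s + t) * (norm x powr p / s powr q) + t / (s + t) * (norm y powr p / t powr q))"
proof -
  define \<theta> where "\<theta> = min 1 p"
  have \<theta>: "0 < \<theta>" "\<theta> \<le> 1" "\<theta> * q = p" using p by (auto simp: \<theta>_def q min_def max_def)
  define u v where "u = norm x powr \<theta>" and "v = norm y powr \<theta>"
  have uv: "0 \<le> u" "0 \<le> v" "u powr q = norm x powr p" "v powr q = norm y powr p"
    by (simp_all add: u_def v_def powr_powr \<theta>)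
  have "norm (x + y) powr \<theta> \<le> (norm x + norm y) powr \<theta>"
    using \<theta> by (intro powr_mono2 norm_triangle_ineq) auto
  also have "\<dots> \<le> u + v"
    unfolding u_def v_def using \<theta> by (intro powr_add_le_add_powr) auto
  finally have "(norm (x + y) powr \<theta>) powr q \<le> (u + v) powr q"
    using q by (intro powr_mono2) auto
  then have "norm (x + y) powr p \<le> (u + v) powr q"
    by (simp add: powr_powr \<theta>)
  also have "u + v = (s + t) * ((1 - t / (s + t)) *\<^sub>R (u / s) + (t / (s + t)) *\<^sub>R (v / t))"
    using st by (simp add: divide_simps)
  also have "\<dots> powr q = (s + t) powr q * ((1 - t / (s + t)) *\<^sub>R (u / s) + (t / (s + t)) *\<^sub>R (v / t)) powr q"
    by (rule powr_mult)
  also have "\<dots> \<le> (s + t) powr q * ((1 - t / (s + t)) * (u / s) powr q + (t / (s + t)) * (v / t) powr q)"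
    using st uv q by (intro mult_left_mono convex_onD[OF convex_on_powr_nonneg]) auto
  also have "1 - t / (s + t) = s / (s + t)"
    using st by (simp add: field_simps)
  finally show ?thesis
    using st uv by (simp add: powr_divide)
qed

text \<open>The exact triangle inequality behind the metric, phrased with bounds s and t instead of
  roots. Both bounds are positive because the pointwise inequality divides by them.\<close>

lemma Lp_mod_add_le:
  fixes f g :: "'a \<Rightarrow> 'b::{real_normed_vector, second_countable_topology}"
  assumes [measurable]: "f \<in> borel_measurable M" "g \<in> borel_measurable M"
    and p: "0 < p" and st: "0 < s" "0 < t" and q: "q = max 1 p"
    and f: "Lp_mod p M f \<le> ennreal (s powr q)" and g: "Lp_mod p M g \<le> ennreal (t powr q)"
  shows "Lp_mod p M (\<lambda>x. f x + g x) \<le> ennreal ((s + t) powr q)"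
proof -
  define a b where "a = (s + t) powr q * (s / (s + t)) / s powr q"
    and "b = (s + t) powr q * (t / (s + t)) / t powr q"
  have ab: "0 \<le> a" "0 \<le> b" using st by (auto simp: a_def b_def)
  have "Lp_mod p M (\<lambda>x. f x + g x)
      \<le> (\<integral>\<^sup>+x. ennreal a * ennreal (norm (f x) powr p) + ennreal b * ennreal (norm (g x) powr p) \<partial>M)"
    unfolding Lp_mod_def
  proof (rule nn_integral_mono)
    fix x
    have "norm (f x + g x) powr p \<le> a * norm (f x) powr p + b * norm (g x) powr p"
      using norm_add_powr_le_weighted[OF p st q, of "f x" "g x"] by (simp add: a_def b_def algebra_simps)
    then have "ennreal (norm (f x + g x) powr p) \<le> ennreal (a * norm (f x) powr p + b * norm (g x) powr p)"
      by (rule ennreal_leI)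
    then show "ennreal (norm (f x + g x) powr p)
        \<le> ennreal a * ennreal (norm (f x) powr p) + ennreal b * ennreal (norm (g x) powr p)"
      using ab by (simp add: ennreal_mult')
  qed
  also have "\<dots> = ennreal a * Lp_mod p M f + ennreal b * Lp_mod p M g"
    unfolding Lp_mod_def by (simp add: nn_integral_add nn_integral_cmult)
  also have "\<dots> \<le> ennreal a * ennreal (s powr q) + ennreal b * ennreal (t powr q)"
    using f g by (intro add_mono mult_left_mono) auto
  also have "\<dots> = ennreal (a * s powr q + b * t powr q)"
    using ab by (simp add: ennreal_mult')
  also have "a * s powr q + b * t powr q = (s + t) powr q * (s / (s + t) + t / (s + t))"
    using st by (simp add: a_def b_def distrib_left)
  also have "\<dots> = (s + t) powr q"
    using st by (simp flip: add_divide_distrib)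
  finally show ?thesis .
qed

text \<open>Cruder than \<open>Lp_mod_add_le\<close>, but it takes no bounds in advance and allows
  the values 0 and \<infinity>; it serves wherever a constant factor is harmless.\<close>

lemma Lp_mod_add_le_two_powr:
  fixes f g :: "'a \<Rightarrow> 'b::{real_normed_vector, second_countable_topology}"
  assumes [measurable]: "f \<in> borel_measurable M" "g \<in> borel_measurable M"
    and p: "0 < p"
  shows "Lp_mod p M (\<lambda>x. f x + g x) \<le> ennreal (2 powr p) * (Lp_mod p M f + Lp_mod p M g)"
proof -
  have "Lp_mod p M (\<lambda>x. f x + g x)
      \<le> (\<integral>\<^sup>+x. ennreal (2 powr p) * (ennreal (norm (f x) powr p) + ennreal (norm (g x) powr p)) \<partial>M)"
    unfolding Lp_mod_def
  proof (rule nn_integral_mono)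
    fix x
    have "norm (f x + g x) powr p \<le> (norm (f x) + norm (g x)) powr p"
      using p by (intro powr_mono2 norm_triangle_ineq) auto
    also have "\<dots> \<le> 2 powr p * (norm (f x) powr p + norm (g x) powr p)"
      using p by (intro powr_add_le_two_powr) auto
    finally show "ennreal (norm (f x + g x) powr p)
        \<le> ennreal (2 powr p) * (ennreal (norm (f x) powr p) + ennreal (norm (g x) powr p))"
      by (simp add: ennreal_leI flip: ennreal_mult' ennreal_plus)
  qed
  also have "\<dots> = ennreal (2 powr p) * (Lp_mod p M f + Lp_mod p M g)"
    unfolding Lp_mod_def by (simp add: nn_integral_add nn_integral_cmult)
  finally show ?thesis .
qed

lemma Lp_mod_diff_commute: "Lp_mod p M (\<lambda>x. f x - g x) = Lp_mod p M (\<lambda>x. g x - f x)"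
  by (simp add: Lp_mod_def norm_minus_commute)

lemma Lp_mod_cong_AE: "AE x in M. f x = g x \<Longrightarrow> Lp_mod p M f = Lp_mod p M g"
  unfolding Lp_mod_def by (intro nn_integral_cong_AE) auto

lemma Lp_mod_eq_0_iff:
  fixes f :: "'a \<Rightarrow> 'b::{real_normed_vector, second_countable_topology}"
  assumes [measurable]: "f \<in> borel_measurable M"
  shows "Lp_mod p M f = 0 \<longleftrightarrow> (AE x in M. f x = 0)"
  unfolding Lp_mod_def by (subst nn_integral_0_iff_AE) auto

text \<open>The factors \<open>2 ^ k\<close> still leave a finite total integral, so for almost
  every x there is C with \<open>norm (h k x) powr p \<le> C * (1/2) ^ k\<close>. Taking p-th roots
  gives a geometric majorant for every p > 0, with no triangle inequality for infinite sums.\<close>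

lemma AE_summable_of_Lp_mod_geometric:
  fixes h :: "nat \<Rightarrow> 'a \<Rightarrow> 'b::{banach, second_countable_topology}"
  assumes [measurable]: "\<And>k. h k \<in> borel_measurable M"
    and p: "0 < p" and h: "\<And>k. Lp_mod p M (h k) \<le> ennreal ((1/4) ^ k)"
  shows "AE x in M. summable (\<lambda>k. h k x)"
proof -
  have "(\<integral>\<^sup>+x. (\<Sum>k. ennreal (2 ^ k) * ennreal (norm (h k x) powr p)) \<partial>M)
      = (\<Sum>k. ennreal (2 ^ k) * Lp_mod p M (h k))"
    unfolding Lp_mod_def by (simp add: nn_integral_suminf nn_integral_cmult)
  also have "\<dots> \<le> (\<Sum>k. ennreal ((1/2) ^ k))"
  proof (rule suminf_le)
    fix k
    have "ennreal (2 ^ k) * Lp_mod p M (h k) \<le> ennreal (2 ^ k) * ennreal ((1/4) ^ k)"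
      using h by (intro mult_left_mono) auto
    also have "\<dots> = ennreal ((1/2) ^ k)"
      by (simp flip: ennreal_mult' power_mult_distrib)
    finally show "ennreal (2 ^ k) * Lp_mod p M (h k) \<le> ennreal ((1/2) ^ k)" .
  qed auto
  also have "\<dots> < \<infinity>"
    by (subst suminf_ennreal2) auto
  finally have "AE x in M. (\<Sum>k. ennreal (2 ^ k) * ennreal (norm (h k x) powr p)) \<noteq> \<infinity>"
    by (intro nn_integral_PInf_AE) auto
  then show ?thesis
  proof (rule AE_mp, intro AE_I2 impI)
    fix x assume fin: "(\<Sum>k. ennreal (2 ^ k) * ennreal (norm (h k x) powr p)) \<noteq> \<infinity>"
    then obtain C where C: "0 \<le> C" "(\<Sum>k. ennreal (2 ^ k) * ennreal (norm (h k x) powr p)) = ennreal C"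
      by (cases "\<Sum>k. ennreal (2 ^ k) * ennreal (norm (h k x) powr p)") auto
    have bound: "norm (h k x) \<le> C powr (1/p) * ((1/2) powr (1/p)) ^ k" for k
    proof -
      have "ennreal (2 ^ k) * ennreal (norm (h k x) powr p) \<le> (\<Sum>k. ennreal (2 ^ k) * ennreal (norm (h k x) powr p))"
        using sum_le_suminf[of "\<lambda>k. ennreal (2 ^ k) * ennreal (norm (h k x) powr p)" "{k}"] by simp
      then have "2 ^ k * norm (h k x) powr p \<le> C"
        unfolding C using C(1) by (simp flip: ennreal_mult')
      then have "norm (h k x) powr p \<le> C * (1/2) ^ k"
        by (simp add: field_simps)
      then have "(norm (h k x) powr p) powr (1/p) \<le> (C * (1/2) ^ k) powr (1/p)"
        using p by (intro powr_mono2) auto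
      also have "\<dots> = C powr (1/p) * ((1/2) powr (1/p)) ^ k"
        using C(1) by (simp add: powr_mult powr_power flip: powr_realpow) (simp add: powr_powr mult.commute)
      finally show ?thesis using p by (simp add: powr_powr)
    qed
    have "summable (\<lambda>k. C powr (1/p) * ((1/2) powr (1/p)) ^ k)"
      using p powr_less_mono2[of "1/p" "1/2" 1] by (intro summable_mult summable_geometric) auto
    then show "summable (\<lambda>k. h k x)"
      by (rule summable_comparison_test') (use bound in auto)
  qed
qed

text \<open>Riesz-Fischer: a rapidly convergent subsequence telescopes to an a.e. summable series,
  and Fatou's lemma transfers the Cauchy estimate to its limit.\<close>

lemma Lp_mod_complete:
  fixes f :: "nat \<Rightarrow> 'a \<Rightarrow> 'b::{banach, second_countable_topology}"
  assumes meas[measurable]: "\<And>k. f k \<in> borel_measurable M" and p: "0 < p"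
    and cauchy: "\<And>\<epsilon>. 0 < \<epsilon> \<Longrightarrow> \<exists>N. \<forall>m\<ge>N. \<forall>n\<ge>N. Lp_mod p M (\<lambda>x. f m x - f n x) \<le> ennreal \<epsilon>"
  shows "\<exists>g\<in>borel_measurable M. \<forall>\<epsilon>>0. \<exists>N. \<forall>n\<ge>N. Lp_mod p M (\<lambda>x. f n x - g x) \<le> ennreal \<epsilon>"
proof -
  have "\<forall>k. \<exists>N. \<forall>m\<ge>N. \<forall>n\<ge>N. Lp_mod p M (\<lambda>x. f m x - f n x) \<le> ennreal ((1/4) ^ k)"
    by (intro allI cauchy) auto
  then obtain N where N: "\<And>k m n. N k \<le> m \<Longrightarrow> N k \<le> n \<Longrightarrow> Lp_mod p M (\<lambda>x. f m x - f n x) \<le> ennreal ((1/4) ^ k)"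
    by metis
  \<comment> \<open>The sum makes r increasing and at least \<open>N k\<close>; the summand k forces
    \<open>k \<le> r k\<close>, so that the subsequence eventually passes every index K in the Fatou
    step.\<close>
  define r where "r k = (\<Sum>i\<le>k. N i) + k" for k
  have r: "N k \<le> r k" "r k \<le> r (Suc k)" "k \<le> r k" for k
    using member_le_sum[of k "{..k}" N] by (auto simp: r_def)
  define h where "h k x = f (r (Suc k)) x - f (r k) x" for k x
  have [measurable]: "h k \<in> borel_measurable M" for k
    unfolding h_def by measurable
  have "AE x in M. summable (\<lambda>k. h k x)"
    by (rule AE_summable_of_Lp_mod_geometric[OF _ p])
       (auto simp: h_def intro!: N order_trans[OF r(1) r(2)] r(1))
  then have ae: "AE x in M. (\<lambda>k. f (r k) x) \<longlonglongrightarrow> f (r 0) x + (\<Sum>k. h k x)"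
  proof (rule AE_mp, intro AE_I2 impI)
    fix x assume "summable (\<lambda>k. h k x)"
    then have "(\<lambda>n. f (r 0) x + (\<Sum>k<n. h k x)) \<longlonglongrightarrow> f (r 0) x + (\<Sum>k. h k x)"
      by (intro tendsto_add tendsto_const summable_LIMSEQ)
    then show "(\<lambda>k. f (r k) x) \<longlonglongrightarrow> f (r 0) x + (\<Sum>k. h k x)"
      by (simp add: h_def sum_lessThan_telescope[of "\<lambda>k. f (r k) x"])
  qed
  \<comment> \<open>Where the series diverges, which happens only on a null set,
    \<open>suminf\<close> still has some value, so g is a total measurable function.\<close>
  define g where "g x = f (r 0) x + (\<Sum>k. h k x)" for x
  have g[measurable]: "g \<in> borel_measurable M"
    unfolding g_def by measurable
  show ?thesis
  proof (intro bexI[OF _ g] allI impI)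
    fix \<epsilon> :: real assume "0 < \<epsilon>"
    then obtain K where K: "\<And>m n. K \<le> m \<Longrightarrow> K \<le> n \<Longrightarrow> Lp_mod p M (\<lambda>x. f m x - f n x) \<le> ennreal \<epsilon>"
      using cauchy by metis
    have "Lp_mod p M (\<lambda>x. f n x - g x) \<le> ennreal \<epsilon>" if n: "K \<le> n" for n
    proof -
      \<comment> \<open>Fatou with n fixed: the integrand is a.e. the limit of
        \<open>norm (f n x - f (r k) x) powr p\<close> in k, and each of these integrals is at most
        \<epsilon> once \<open>r k\<close> exceeds K.\<close>
      have "Lp_mod p M (\<lambda>x. f n x - g x)
          = (\<integral>\<^sup>+x. liminf (\<lambda>k. ennreal (norm (f n x - f (r k) x) powr p)) \<partial>M)"
        unfolding Lp_mod_def
      proof (rule nn_integral_cong_AE, rule AE_mp[OF ae], intro AE_I2 impI)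
        fix x assume "(\<lambda>k. f (r k) x) \<longlonglongrightarrow> f (r 0) x + (\<Sum>k. h k x)"
        then have "(\<lambda>k. ennreal (norm (f n x - f (r k) x) powr p)) \<longlonglongrightarrow> ennreal (norm (f n x - g x) powr p)"
          using p unfolding g_def by (intro tendsto_intros) auto
        then show "ennreal (norm (f n x - g x) powr p) = liminf (\<lambda>k. ennreal (norm (f n x - f (r k) x) powr p))"
          by (intro lim_imp_Liminf[symmetric] trivial_limit_sequentially)
      qed
      also have "\<dots> \<le> liminf (\<lambda>k. Lp_mod p M (\<lambda>x. f n x - f (r k) x))"
        unfolding Lp_mod_def by (intro nn_integral_liminf) auto
      also have "\<dots> \<le> liminf (\<lambda>k. ennreal \<epsilon>)"
        using n by (intro Liminf_mono eventually_sequentiallyI[of K] K) (auto intro: order_trans r(3))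
      finally show ?thesis by (simp add: Liminf_const)
    qed
    then show "\<exists>N. \<forall>n\<ge>N. Lp_mod p M (\<lambda>x. f n x - g x) \<le> ennreal \<epsilon>" by blast
  qed
qed

subsection \<open>The metric of the weighted space\<close>

lemma ennreal_powr_less_iff:
  assumes "0 < p" "0 < c"
  shows "ennreal_powr a (1 / p) < ennreal c \<longleftrightarrow> a < ennreal (c powr p)"
proof (cases a)
  case (real x)
  have "x powr (1 / p) < c \<longleftrightarrow> x < c powr p"
    using powr_less_mono2[of p "x powr (1 / p)" c] powr_less_mono2[of "1 / p" x "c powr p"] assms real
    by (auto simp: powr_powr)
  with real assms show ?thesis by (simp add: ennreal_powr_def ennreal_less_iff)
qed (simp add: ennreal_powr_def)

lemma ennreal_powr_less_top_iff: "ennreal_powr a r < \<infinity> \<longleftrightarrow> a < \<infinity>"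
  by (simp add: ennreal_powr_def less_top)

lemma Lp_norm_eq_Lp_mod:
  fixes f :: "real ^ 'n \<Rightarrow> 'b::{real_normed_field, euclidean_space}"
  assumes [measurable]: "\<omega> \<in> borel_measurable lebesgue" "f \<in> borel_measurable lebesgue"
  shows "Lp_norm p \<omega> f = ennreal_powr (Lp_mod p (density lebesgue \<omega>) f) (1 / p)"
  unfolding Lp_norm_def Lp_mod_def by (subst nn_integral_density) (simp_all add: mult.commute)

lemma weight_measurable: "weight \<omega> \<Longrightarrow> \<omega> \<in> borel_measurable lebesgue"
  by (simp add: weight_def)

text \<open>Since \<omega> is positive a.e., the weighted measure and Lebesgue measure have the same
  null sets. Thus \<open>ae_class\<close>, defined by Lebesgue measure, also identifies exactly the
  functions at weighted distance 0.\<close>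

lemma AE_density_weight_iff:
  assumes "weight \<omega>"
  shows "(AE x in density lebesgue \<omega>. P x) \<longleftrightarrow> (AE x in lebesgue. P x)"
proof -
  have "AE x in lebesgue. 0 < \<omega> x" using assms by (auto simp: weight_def)
  then show ?thesis
    by (subst AE_density[OF weight_measurable[OF assms]]) (auto elim: AE_mp)
qed

lemma Lp_functions_iff:
  fixes f :: "real ^ 'n \<Rightarrow> 'b::{real_normed_field, euclidean_space}"
  assumes "weight \<omega>"
  shows "f \<in> Lp_functions p \<omega> \<longleftrightarrow>
    f \<in> borel_measurable lebesgue \<and> Lp_mod p (density lebesgue \<omega>) f < \<infinity>"
  using Lp_norm_eq_Lp_mod[OF weight_measurable[OF assms], of f p] ennreal_powr_less_top_iff
  by (auto simp: Lp_functions_def)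

lemma ae_class_eq_iff:
  assumes "f \<in> borel_measurable lebesgue" "g \<in> borel_measurable lebesgue"
  shows "ae_class f = ae_class g \<longleftrightarrow> (AE x in lebesgue. f x = g x)"
proof
  assume "ae_class f = ae_class g"
  moreover have "f \<in> ae_class f" using assms by (simp add: ae_class_def)
  ultimately show "AE x in lebesgue. f x = g x" by (simp add: ae_class_def)
next
  assume "AE x in lebesgue. f x = g x"
  then have "(AE x in lebesgue. h x = f x) \<longleftrightarrow> (AE x in lebesgue. h x = g x)" for h
    by (auto elim: AE_mp)
  then show "ae_class f = ae_class g" by (simp add: ae_class_def)
qed

lemma mem_Lp_space_iff: "A \<in> Lp_space p \<omega> \<longleftrightarrow> (\<exists>f\<in>Lp_functions p \<omega>. A = ae_class f)"
  by (auto simp: Lp_space_def)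

text \<open>Representatives are chosen by \<open>SOME\<close>, which makes the distance total:
  nonnegativity and symmetry of a metric are demanded for arbitrary arguments. On classes of the
  space the choice does not matter, and \<open>enn2real\<close> loses nothing because the integral
  is finite there.\<close>

definition Lp_dist ::
    "real \<Rightarrow> (real ^ 'n \<Rightarrow> ennreal) \<Rightarrow> (real ^ 'n \<Rightarrow> 'b::{real_normed_field, euclidean_space}) set
      \<Rightarrow> (real ^ 'n \<Rightarrow> 'b) set \<Rightarrow> real"
  where "Lp_dist p \<omega> A B =
    enn2real (Lp_mod p (density lebesgue \<omega>) (\<lambda>x. (SOME f. f \<in> A) x - (SOME g. g \<in> B) x)) powr (1 / max 1 p)"

section \<open>Metric axioms, topology and completeness of the weighted space\<close>

context
  fixes p :: real and \<omega> :: "real ^ 'n \<Rightarrow> ennreal"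
  assumes p: "0 < p" and \<omega>: "weight \<omega>"
begin

lemma Lp_mod_diff_finite:
  fixes f g :: "real ^ 'n \<Rightarrow> 'b::{real_normed_field, euclidean_space}"
  assumes "f \<in> Lp_functions p \<omega>" "g \<in> Lp_functions p \<omega>"
  shows "Lp_mod p (density lebesgue \<omega>) (\<lambda>x. f x - g x) < \<infinity>"
proof -
  let ?M = "density lebesgue \<omega>"
  have fg: "f \<in> borel_measurable ?M" "g \<in> borel_measurable ?M" "Lp_mod p ?M f < \<infinity>" "Lp_mod p ?M g < \<infinity>"
    using assms by (auto simp: Lp_functions_iff[OF \<omega>])
  have "Lp_mod p ?M (\<lambda>x. f x + - g x) \<le> ennreal (2 powr p) * (Lp_mod p ?M f + Lp_mod p ?M (\<lambda>x. - g x))"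
    using fg by (intro Lp_mod_add_le_two_powr p) auto
  also have "\<dots> < \<infinity>"
    using fg by (simp add: Lp_mod_def ennreal_mult_less_top)
  finally show ?thesis by simp
qed

lemma Lp_dist_ae_class:
  fixes f g :: "real ^ 'n \<Rightarrow> 'b::{real_normed_field, euclidean_space}"
  assumes "f \<in> Lp_functions p \<omega>" "g \<in> Lp_functions p \<omega>"
  shows "Lp_dist p \<omega> (ae_class f) (ae_class g) =
    enn2real (Lp_mod p (density lebesgue \<omega>) (\<lambda>x. f x - g x)) powr (1 / max 1 p)"
proof -
  have rep: "AE x in lebesgue. (SOME f. f \<in> ae_class h) x = h x"
    if "h \<in> Lp_functions p \<omega>" for h :: "real ^ 'n \<Rightarrow> 'b"
  proof -
    have "h \<in> ae_class h" using that by (simp add: ae_class_def Lp_functions_def)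
    then have "(SOME f. f \<in> ae_class h) \<in> ae_class h" by (metis someI)
    then show ?thesis by (simp add: ae_class_def)
  qed
  have "Lp_mod p (density lebesgue \<omega>) (\<lambda>x. (SOME f'. f' \<in> ae_class f) x - (SOME g'. g' \<in> ae_class g) x)
      = Lp_mod p (density lebesgue \<omega>) (\<lambda>x. f x - g x)"
    using rep[OF assms(1)] rep[OF assms(2)]
    by (intro Lp_mod_cong_AE) (auto simp: AE_density_weight_iff[OF \<omega>] elim!: AE_mp)
  then show ?thesis by (simp add: Lp_dist_def)
qed

lemma Lp_dist_less_iff:
  fixes f g :: "real ^ 'n \<Rightarrow> 'b::{real_normed_field, euclidean_space}"
  assumes "f \<in> Lp_functions p \<omega>" "g \<in> Lp_functions p \<omega>" "0 < c"
  shows "Lp_dist p \<omega> (ae_class f) (ae_class g) < c \<longleftrightarrow>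
    Lp_mod p (density lebesgue \<omega>) (\<lambda>x. f x - g x) < ennreal (c powr max 1 p)"
proof -
  let ?a = "Lp_mod p (density lebesgue \<omega>) (\<lambda>x. f x - g x)"
  have "ennreal_powr ?a (1 / max 1 p) = ennreal (Lp_dist p \<omega> (ae_class f) (ae_class g))"
    using Lp_mod_diff_finite[OF assms(1,2)] by (simp add: Lp_dist_ae_class[OF assms(1,2)] ennreal_powr_def)
  with ennreal_powr_less_iff[of "max 1 p" c ?a] assms(3) show ?thesis
    by (simp add: ennreal_less_iff Lp_dist_def)
qed

lemma Metric_space_Lp_dist:
  "Metric_space (Lp_space p \<omega> :: (real ^ 'n \<Rightarrow> 'b::{real_normed_field, euclidean_space}) set set) (Lp_dist p \<omega>)"
proof
  fix A B C :: "(real ^ 'n \<Rightarrow> 'b) set"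
  show "0 \<le> Lp_dist p \<omega> A B" by (simp add: Lp_dist_def)
  show "Lp_dist p \<omega> A B = Lp_dist p \<omega> B A"
    unfolding Lp_dist_def by (subst Lp_mod_diff_commute) (rule refl)
  assume "A \<in> Lp_space p \<omega>" "B \<in> Lp_space p \<omega>"
  then obtain f g where f: "f \<in> Lp_functions p \<omega>" "A = ae_class f"
    and g: "g \<in> Lp_functions p \<omega>" "B = ae_class g" by (auto simp: Lp_space_def)
  have meas: "f \<in> borel_measurable lebesgue" "g \<in> borel_measurable lebesgue"
    using f g by (auto simp: Lp_functions_def)
  let ?M = "density lebesgue \<omega>"
  have "Lp_dist p \<omega> A B = 0 \<longleftrightarrow> Lp_mod p ?M (\<lambda>x. f x - g x) = 0"
    using Lp_mod_diff_finite[OF f(1) g(1)] unfolding f g Lp_dist_ae_class[OF f(1) g(1)]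
    by (auto simp: enn2real_eq_0_iff)
  also have "\<dots> \<longleftrightarrow> A = B"
    using meas unfolding f g by (simp add: Lp_mod_eq_0_iff AE_density_weight_iff[OF \<omega>] ae_class_eq_iff)
  finally show "Lp_dist p \<omega> A B = 0 \<longleftrightarrow> A = B" .
  assume "C \<in> Lp_space p \<omega>"
  then obtain h where h: "h \<in> Lp_functions p \<omega>" "C = ae_class h" by (auto simp: Lp_space_def)
  have meash: "h \<in> borel_measurable lebesgue" using h by (auto simp: Lp_functions_def)
  show "Lp_dist p \<omega> A C \<le> Lp_dist p \<omega> A B + Lp_dist p \<omega> B C"
  proof (rule field_le_epsilon)
    fix e :: real assume e: "0 < e"
    \<comment> \<open>The slack \<open>e / 4\<close> makes s and t positive and turns the distances
      into strict bounds; a further \<open>e / 2\<close> restores strictness after adding, for a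
      total slack of e.\<close>
    define s t where "s = Lp_dist p \<omega> A B + e / 4" and "t = Lp_dist p \<omega> B C + e / 4"
    have st: "0 < s" "0 < t" using e by (auto simp: s_def t_def Lp_dist_def add_nonneg_pos)
    have "Lp_mod p ?M (\<lambda>x. f x - g x) \<le> ennreal (s powr max 1 p)"
      using Lp_dist_less_iff[OF f(1) g(1) st(1)] e f g by (simp add: s_def)
    moreover have "Lp_mod p ?M (\<lambda>x. g x - h x) \<le> ennreal (t powr max 1 p)"
      using Lp_dist_less_iff[OF g(1) h(1) st(2)] e g h by (simp add: t_def)
    ultimately have "Lp_mod p ?M (\<lambda>x. (f x - g x) + (g x - h x)) \<le> ennreal ((s + t) powr max 1 p)"
      using meas meash by (intro Lp_mod_add_le p st refl) auto
    also have "\<dots> < ennreal ((s + t + e / 2) powr max 1 p)"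
      using st e by (intro ennreal_lessI powr_less_mono2) auto
    finally have "Lp_dist p \<omega> A C < s + t + e / 2"
      using Lp_dist_less_iff[OF f(1) h(1), of "s + t + e / 2"] f h st e by simp
    then show "Lp_dist p \<omega> A C \<le> Lp_dist p \<omega> A B + Lp_dist p \<omega> B C + e"
      by (simp add: s_def t_def)
  qed
qed

text \<open>Both quantities are powers of one integral, with exponents \<open>1 / p\<close> and
  \<open>1 / max 1 p\<close>, which explains the radius
  \<open>\<epsilon> powr (p / max 1 p)\<close>.\<close>

lemma Lp_norm_diff_less_iff:
  fixes f g :: "real ^ 'n \<Rightarrow> 'b::{real_normed_field, euclidean_space}"
  assumes f: "f \<in> Lp_functions p \<omega>" and g: "g \<in> Lp_functions p \<omega>" and e: "0 < \<epsilon>"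
  shows "Lp_norm p \<omega> (\<lambda>x. g x - f x) < ennreal \<epsilon> \<longleftrightarrow>
    Lp_dist p \<omega> (ae_class f) (ae_class g) < \<epsilon> powr (p / max 1 p)"
proof -
  have "Lp_norm p \<omega> (\<lambda>x. g x - f x) = ennreal_powr (Lp_mod p (density lebesgue \<omega>) (\<lambda>x. f x - g x)) (1 / p)"
    using f g by (subst Lp_mod_diff_commute)
      (auto simp: Lp_functions_def intro!: Lp_norm_eq_Lp_mod weight_measurable[OF \<omega>])
  then show ?thesis
    using ennreal_powr_less_iff[OF p e] Lp_dist_less_iff[OF f g, of "\<epsilon> powr (p / max 1 p)"] e
    by (simp add: powr_powr max_def)
qed

lemma Lp_ball_eq_mball:
  fixes f :: "real ^ 'n \<Rightarrow> 'b::{real_normed_field, euclidean_space}"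
  assumes f: "f \<in> Lp_functions p \<omega>" and e: "0 < \<epsilon>"
  shows "Lp_ball p \<omega> f \<epsilon> =
    Metric_space.mball (Lp_space p \<omega>) (Lp_dist p \<omega>) (ae_class f) (\<epsilon> powr (p / max 1 p))"
proof -
  interpret Metric_space "Lp_space p \<omega> :: (real ^ 'n \<Rightarrow> 'b) set set" "Lp_dist p \<omega>"
    by (rule Metric_space_Lp_dist)
  show ?thesis
    using f Lp_norm_diff_less_iff[OF f _ e] by (auto simp: Lp_ball_def mem_Lp_space_iff)
qed

text \<open>Quasi-norm balls and metric balls around a class are the same sets up to an increasing
  bijection of the positive radii, with inverse \<open>r powr (max 1 p / p)\<close>; hence both
  define the same open sets.\<close>

lemma mtopology_Lp_dist:
  "Metric_space.mtopology (Lp_space p \<omega>) (Lp_dist p \<omega>) =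
    (Lp_topology p \<omega> :: (real ^ 'n \<Rightarrow> 'b::{real_normed_field, euclidean_space}) set topology)"
proof -
  interpret Metric_space "Lp_space p \<omega> :: (real ^ 'n \<Rightarrow> 'b) set set" "Lp_dist p \<omega>"
    by (rule Metric_space_Lp_dist)
  have ball: "(\<exists>\<epsilon>>0. Lp_ball p \<omega> f \<epsilon> \<subseteq> U) \<longleftrightarrow> (\<exists>r>0. mball (ae_class f) r \<subseteq> U)"
    if f: "f \<in> Lp_functions p \<omega>" for f :: "real ^ 'n \<Rightarrow> 'b" and U
  proof
    assume "\<exists>\<epsilon>>0. Lp_ball p \<omega> f \<epsilon> \<subseteq> U"
    then obtain \<epsilon> where "0 < \<epsilon>" "Lp_ball p \<omega> f \<epsilon> \<subseteq> U" by blast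
    then show "\<exists>r>0. mball (ae_class f) r \<subseteq> U"
      by (intro exI[of _ "\<epsilon> powr (p / max 1 p)"]) (simp add: Lp_ball_eq_mball[OF f])
  next
    assume "\<exists>r>0. mball (ae_class f) r \<subseteq> U"
    then obtain r where r: "0 < r" "mball (ae_class f) r \<subseteq> U" by blast
    then have "Lp_ball p \<omega> f (r powr (max 1 p / p)) = mball (ae_class f) r"
      using p by (simp add: Lp_ball_eq_mball[OF f] powr_powr max_def)
    with r show "\<exists>\<epsilon>>0. Lp_ball p \<omega> f \<epsilon> \<subseteq> U"
      by (intro exI[of _ "r powr (max 1 p / p)"]) simp
  qed
  have "openin mtopology U \<longleftrightarrow> openin (Lp_topology p \<omega>) U" for U :: "(real ^ 'n \<Rightarrow> 'b) set set"
    unfolding openin_Lp_topology openin_mtopology Lp_open_def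
  proof (intro conj_cong refl)
    assume U: "U \<subseteq> Lp_space p \<omega>"
    have "(\<forall>x. x \<in> U \<longrightarrow> (\<exists>r>0. mball x r \<subseteq> U)) \<longleftrightarrow>
      (\<forall>f\<in>Lp_functions p \<omega>. ae_class f \<in> U \<longrightarrow> (\<exists>r>0. mball (ae_class f) r \<subseteq> U))"
      using U unfolding Lp_space_def by blast
    then show "(\<forall>x. x \<in> U \<longrightarrow> (\<exists>r>0. mball x r \<subseteq> U)) \<longleftrightarrow>
      (\<forall>f\<in>Lp_functions p \<omega>. ae_class f \<in> U \<longrightarrow> (\<exists>\<epsilon>>0. Lp_ball p \<omega> f \<epsilon> \<subseteq> U))"
      using ball by simp
  qed
  then show ?thesis by (simp add: topology_eq)
qed

lemma mcomplete_Lp_dist: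
  "Metric_space.mcomplete (Lp_space p \<omega> :: (real ^ 'n \<Rightarrow> 'b::{real_normed_field, euclidean_space}) set set)
    (Lp_dist p \<omega>)"
proof -
  interpret Metric_space "Lp_space p \<omega> :: (real ^ 'n \<Rightarrow> 'b) set set" "Lp_dist p \<omega>"
    by (rule Metric_space_Lp_dist)
  let ?M = "density lebesgue \<omega>"
  show ?thesis
    unfolding mcomplete_def
  proof (intro allI impI)
    fix \<sigma> :: "nat \<Rightarrow> (real ^ 'n \<Rightarrow> 'b) set"
    assume \<sigma>: "MCauchy \<sigma>"
    then have "\<forall>n. \<exists>f\<in>Lp_functions p \<omega>. \<sigma> n = ae_class f"
      unfolding MCauchy_def by (auto simp flip: mem_Lp_space_iff)
    then obtain f where f: "\<And>n. f n \<in> Lp_functions p \<omega>" "\<And>n. \<sigma> n = ae_class (f n)"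
      by metis
    have meas: "f n \<in> borel_measurable ?M" for n
      using f(1)[of n] by (simp add: Lp_functions_def)
    have "\<exists>N. \<forall>m\<ge>N. \<forall>n\<ge>N. Lp_mod p ?M (\<lambda>x. f m x - f n x) \<le> ennreal \<epsilon>" if "0 < \<epsilon>" for \<epsilon>
    proof -
      have e: "0 < \<epsilon> powr (1 / max 1 p)" using that by simp
      then obtain N where "\<And>n n'. N \<le> n \<Longrightarrow> N \<le> n' \<Longrightarrow> Lp_dist p \<omega> (\<sigma> n) (\<sigma> n') < \<epsilon> powr (1 / max 1 p)"
        using \<sigma> unfolding MCauchy_def by blast
      moreover have "max 1 p \<noteq> 0" using p by (simp add: max_def)
      ultimately show ?thesis
        using Lp_dist_less_iff[OF f(1) f(1) e] that
        by (intro exI[of _ N]) (auto simp: f(2) powr_powr intro!: less_imp_le)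
    qed
    from Lp_mod_complete[OF meas p this] obtain g where g: "g \<in> borel_measurable ?M"
      "\<And>\<epsilon>. 0 < \<epsilon> \<Longrightarrow> \<exists>N. \<forall>n\<ge>N. Lp_mod p ?M (\<lambda>x. f n x - g x) \<le> ennreal \<epsilon>"
      by auto
    obtain N where N: "Lp_mod p ?M (\<lambda>x. f N x - g x) \<le> ennreal 1"
      using g(2)[of 1] by auto
    \<comment> \<open>The limit is so far only measurable; its integral is finite because g differs
      from one member \<open>f N\<close> by a function with finite integral.\<close>
    have "Lp_mod p ?M (\<lambda>x. f N x + (g x - f N x)) \<le>
        ennreal (2 powr p) * (Lp_mod p ?M (f N) + Lp_mod p ?M (\<lambda>x. g x - f N x))"
      using g(1) meas by (intro Lp_mod_add_le_two_powr p) auto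
    also have "\<dots> < \<infinity>"
      using N f(1)[of N] Lp_mod_diff_commute[of p ?M g "f N"]
      by (auto simp: Lp_functions_iff[OF \<omega>] ennreal_mult_less_top intro: order_le_less_trans)
    finally have gL: "g \<in> Lp_functions p \<omega>"
      using g(1) by (simp add: Lp_functions_iff[OF \<omega>])
    have "\<exists>N. \<forall>n\<ge>N. Lp_dist p \<omega> (\<sigma> n) (ae_class g) < \<epsilon>" if e: "0 < \<epsilon>" for \<epsilon>
    proof -
      obtain N where N: "\<forall>n\<ge>N. Lp_mod p ?M (\<lambda>x. f n x - g x) \<le> ennreal ((\<epsilon> / 2) powr max 1 p)"
        using g(2)[of "(\<epsilon> / 2) powr max 1 p"] e by auto
      have "ennreal ((\<epsilon> / 2) powr max 1 p) < ennreal (\<epsilon> powr max 1 p)"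
        using e by (intro ennreal_lessI powr_less_mono2) auto
      then show ?thesis
        using N Lp_dist_less_iff[OF f(1) gL e] by (intro exI[of _ N]) (auto simp: f(2) intro: order_le_less_trans)
    qed
    moreover have "\<sigma> n \<in> Lp_space p \<omega>" for n
      using f by (auto simp: mem_Lp_space_iff)
    moreover have "ae_class g \<in> Lp_space p \<omega>"
      using gL by (auto simp: mem_Lp_space_iff)
    ultimately have "limitin mtopology \<sigma> (ae_class g) sequentially"
      by (simp add: limit_metric_sequentially)
    then show "\<exists>x. limitin mtopology \<sigma> x sequentially" by blast
  qed
qed

text \<open>Leaves only estimates of \<open>Lp_mod\<close> to be proved. The centres are required in
  F itself because both notions of total boundedness ask for centres in the family.\<close>

lemma relatively_compact_Lp_if_finite_nets:
  fixes F :: "(real ^ 'n \<Rightarrow> 'b::{real_normed_field, euclidean_space}) set"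
  assumes F: "F \<subseteq> Lp_functions p \<omega>"
    and net: "\<And>\<epsilon>. 0 < \<epsilon> \<Longrightarrow> \<exists>K. finite K \<and> K \<subseteq> F \<and>
      (\<forall>f\<in>F. \<exists>g\<in>K. Lp_mod p (density lebesgue \<omega>) (\<lambda>x. f x - g x) < ennreal \<epsilon>)"
  shows "relatively_compact_in (Lp_topology p \<omega>) (ae_class ` F) \<and> Lp_totally_bounded p \<omega> F"
proof -
  interpret Metric_space "Lp_space p \<omega> :: (real ^ 'n \<Rightarrow> 'b) set set" "Lp_dist p \<omega>"
    by (rule Metric_space_Lp_dist)
  have cover: "\<exists>K. finite K \<and> K \<subseteq> F \<and> ae_class ` F \<subseteq> (\<Union>g\<in>K. mball (ae_class g) \<epsilon>)" if e: "0 < \<epsilon>" for \<epsilon>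
  proof -
    obtain K where K: "finite K" "K \<subseteq> F"
      "\<forall>f\<in>F. \<exists>g\<in>K. Lp_mod p (density lebesgue \<omega>) (\<lambda>x. f x - g x) < ennreal (\<epsilon> powr max 1 p)"
      using net[of "\<epsilon> powr max 1 p"] e by auto
    have "ae_class f \<in> (\<Union>g\<in>K. mball (ae_class g) \<epsilon>)" if f: "f \<in> F" for f
    proof -
      obtain g where g: "g \<in> K" "Lp_mod p (density lebesgue \<omega>) (\<lambda>x. f x - g x) < ennreal (\<epsilon> powr max 1 p)"
        using K f by blast
      have "f \<in> Lp_functions p \<omega>" "g \<in> Lp_functions p \<omega>" using F K f g by auto
      with g e have "ae_class f \<in> mball (ae_class g) \<epsilon>"
        using Lp_dist_less_iff[of f g \<epsilon>] by (auto simp: mem_Lp_space_iff commute)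
      with g show ?thesis by blast
    qed
    with K show ?thesis by blast
  qed
  have "mtotally_bounded (ae_class ` F)"
    unfolding mtotally_bounded_def
  proof (intro allI impI)
    fix \<epsilon> :: real assume "0 < \<epsilon>"
    from cover[OF this] obtain K
      where "finite K" "K \<subseteq> F" "ae_class ` F \<subseteq> (\<Union>g\<in>K. mball (ae_class g) \<epsilon>)"
      by (elim exE conjE)
    then show "\<exists>K. finite K \<and> K \<subseteq> ae_class ` F \<and> ae_class ` F \<subseteq> (\<Union>x\<in>K. mball x \<epsilon>)"
      by (intro exI[of _ "ae_class ` K"]) auto
  qed
  then have "ae_class ` F \<subseteq> Lp_space p \<omega> \<and> compactin mtopology (mtopology closure_of (ae_class ` F))"
    unfolding mtotally_bounded_eq_compact_closure_of[OF mcomplete_Lp_dist] .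
  then have "relatively_compact_in (Lp_topology p \<omega>) (ae_class ` F)"
    unfolding relatively_compact_in_def topspace_Lp_topology mtopology_Lp_dist .
  moreover have "Lp_totally_bounded p \<omega> F"
    unfolding Lp_totally_bounded_def
  proof (intro allI impI)
    fix \<epsilon> :: real assume e: "0 < \<epsilon>"
    then obtain K where K: "finite K" "K \<subseteq> F"
      "ae_class ` F \<subseteq> (\<Union>g\<in>K. mball (ae_class g) (\<epsilon> powr (p / max 1 p)))"
      using cover[of "\<epsilon> powr (p / max 1 p)"] by auto
    moreover have "(\<Union>g\<in>K. mball (ae_class g) (\<epsilon> powr (p / max 1 p))) = (\<Union>g\<in>K. Lp_ball p \<omega> g \<epsilon>)"
      using K(2) F e by (intro SUP_cong refl Lp_ball_eq_mball[symmetric]) auto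
    ultimately show "\<exists>K. finite K \<and> K \<subseteq> F \<and> ae_class ` F \<subseteq> (\<Union>f\<in>K. Lp_ball p \<omega> f \<epsilon>)"
      by auto
  qed
  ultimately show ?thesis ..
qed

end

subsection \<open>Step functions on a grid\<close>

lemma nn_integral_lborel_reflect:
  fixes h :: "'a::euclidean_space \<Rightarrow> ennreal"
  assumes [measurable]: "h \<in> borel_measurable borel"
  shows "(\<integral>\<^sup>+z. h z \<partial>lborel) = (\<integral>\<^sup>+y. h (x - y) \<partial>lborel)"
  by (subst lborel_affine[of "-1" x]) (simp_all add: nn_integral_density nn_integral_distr)

lemma AE_lborel_translate:
  fixes y :: "'a::euclidean_space"
  assumes "AE x in lborel. P x"
  shows "AE x in lborel. P (x - y)"
proof -
  have "AE x in distr lborel borel ((+) (- y)). P x"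
    using assms by (simp only: lborel_distr_plus)
  then have "AE x in lborel. P (- y + x)" by (rule AE_distrD[rotated]) simp
  then show ?thesis by simp
qed

text \<open>The real-valued case is applied to each coordinate; the basis is finite, so the
  exceptional null sets can be united.\<close>

lemma completion_ex_borel_measurable_euclidean:
  fixes f :: "'a \<Rightarrow> 'b::euclidean_space"
  assumes f: "f \<in> borel_measurable (completion M)"
  obtains g where "g \<in> borel_measurable M" "AE x in M. f x = g x"
proof -
  have "\<forall>b\<in>Basis. \<exists>h\<in>borel_measurable M. AE x in M. f x \<bullet> b = h x"
    using f by (intro ballI completion_ex_borel_measurable_real) auto
  then obtain h where h: "\<And>b. b \<in> Basis \<Longrightarrow> h b \<in> borel_measurable M"
    "\<And>b. b \<in> Basis \<Longrightarrow> AE x in M. f x \<bullet> b = h b x"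
    by metis
  show thesis
  proof (rule that)
    show "(\<lambda>x. \<Sum>b\<in>Basis. h b x *\<^sub>R b) \<in> borel_measurable M"
      using h(1) by (intro borel_measurable_sum) auto
    have "AE x in M. \<forall>b\<in>Basis. f x \<bullet> b = h b x"
      using h(2) by (intro AE_finite_allI) auto
    then show "AE x in M. f x = (\<Sum>b\<in>Basis. h b x *\<^sub>R b)"
    proof (rule AE_mp, intro AE_I2 impI)
      fix x assume "\<forall>b\<in>Basis. f x \<bullet> b = h b x"
      then show "f x = (\<Sum>b\<in>Basis. h b x *\<^sub>R b)"
        by (subst euclidean_representation[symmetric]) (auto intro!: sum.cong)
    qed
  qed
qed

text \<open>The half-open cube with corner \<open>k i * \<delta>\<close>. Describing it by floors
  makes disjointness immediate and tells which cell contains a given point.\<close>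

definition grid_cell :: "real \<Rightarrow> ('n \<Rightarrow> int) \<Rightarrow> (real ^ 'n) set" where
  "grid_cell \<delta> k = {x. \<forall>i. \<lfloor>x $ i / \<delta>\<rfloor> = k i}"

text \<open>The set of differences of two points of one cell, used in place of a ball because its
  volume relative to a cell is explicit.\<close>

definition open_cube :: "real \<Rightarrow> (real ^ 'n) set" where
  "open_cube \<delta> = box (\<chi> i. - \<delta>) (\<chi> i. \<delta>)"

lemma mem_open_cube_iff: "y \<in> open_cube \<delta> \<longleftrightarrow> (\<forall>i. \<bar>y $ i\<bar> < \<delta>)"
  by (auto simp: open_cube_def mem_box_cart abs_less_iff minus_less_iff)

section \<open>Volumes and differences of cells\<close>

lemma prod_Basis_const_diff:
  "(\<Prod>b\<in>Basis. ((\<chi> i. u i + d) - (\<chi> i. u i) :: real ^ 'n) \<bullet> b) = d ^ CARD('n)"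
proof -
  have "(\<Prod>b\<in>Basis. ((\<chi> i. u i + d) - (\<chi> i. u i) :: real ^ 'n) \<bullet> b) = (\<Prod>b\<in>(Basis :: (real ^ 'n) set). d)"
    by (intro prod.cong refl) (auto simp: Basis_vec_def inner_axis)
  then show ?thesis by simp
qed

lemma
  fixes u :: "'n::finite \<Rightarrow> real"
  assumes "0 \<le> d"
  shows emeasure_lborel_cube: "emeasure lborel (box (\<chi> i. u i) (\<chi> i. u i + d)) = ennreal (d ^ CARD('n))"
    and emeasure_lborel_closed_cube: "emeasure lborel (cbox (\<chi> i. u i) (\<chi> i. u i + d)) = ennreal (d ^ CARD('n))"
proof -
  have "\<forall>b\<in>Basis. (\<chi> i. u i) \<bullet> b \<le> (\<chi> i. u i + d) \<bullet> b"
    using assms by (auto simp: Basis_vec_def inner_axis)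
  then show "emeasure lborel (box (\<chi> i. u i) (\<chi> i. u i + d)) = ennreal (d ^ CARD('n))"
    "emeasure lborel (cbox (\<chi> i. u i) (\<chi> i. u i + d)) = ennreal (d ^ CARD('n))"
    using prod_Basis_const_diff[of u d] by auto
qed

lemma emeasure_open_cube:
  assumes "0 < \<delta>"
  shows "emeasure lborel (open_cube \<delta> :: (real ^ 'n) set) = ennreal ((2 * \<delta>) ^ CARD('n))"
  using emeasure_lborel_cube[of "2 * \<delta>" "\<lambda>i::'n. - \<delta>"] assms by (simp add: open_cube_def)

lemma borel_grid_cell[measurable]: "grid_cell \<delta> k \<in> sets borel"
  unfolding grid_cell_def by measurable

lemma
  fixes k :: "'n::finite \<Rightarrow> int"
  assumes \<delta>: "0 < \<delta>"
  shows box_subset_grid_cell: "box (\<chi> i. of_int (k i) * \<delta>) (\<chi> i. of_int (k i) * \<delta> + \<delta>) \<subseteq> grid_cell \<delta> k"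
    and grid_cell_subset_cbox: "grid_cell \<delta> k \<subseteq> cbox (\<chi> i. of_int (k i) * \<delta>) (\<chi> i. of_int (k i) * \<delta> + \<delta>)"
proof -
  have cell: "x \<in> grid_cell \<delta> k \<longleftrightarrow> (\<forall>i. of_int (k i) * \<delta> \<le> x $ i \<and> x $ i < of_int (k i) * \<delta> + \<delta>)" for x
  proof -
    have "\<lfloor>x $ i / \<delta>\<rfloor> = k i \<longleftrightarrow> of_int (k i) * \<delta> \<le> x $ i \<and> x $ i < of_int (k i) * \<delta> + \<delta>" for i
      using \<delta> by (simp add: floor_eq_iff field_simps)
    then show ?thesis by (simp add: grid_cell_def)
  qed
  show "box (\<chi> i. of_int (k i) * \<delta>) (\<chi> i. of_int (k i) * \<delta> + \<delta>) \<subseteq> grid_cell \<delta> k"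
    by (auto simp: cell mem_box_cart less_eq_real_def)
  show "grid_cell \<delta> k \<subseteq> cbox (\<chi> i. of_int (k i) * \<delta>) (\<chi> i. of_int (k i) * \<delta> + \<delta>)"
    by (auto simp: cell mem_box_cart less_eq_real_def)
qed

text \<open>The cell lies between an open and a closed cube of equal volume.\<close>

lemma emeasure_grid_cell:
  fixes k :: "'n::finite \<Rightarrow> int"
  assumes \<delta>: "0 < \<delta>"
  shows "emeasure lborel (grid_cell \<delta> k) = ennreal (\<delta> ^ CARD('n))"
proof (rule antisym)
  show "emeasure lborel (grid_cell \<delta> k) \<le> ennreal (\<delta> ^ CARD('n))"
    using emeasure_mono[OF grid_cell_subset_cbox[OF \<delta>, of k], of lborel] \<delta>
    by (simp add: emeasure_lborel_closed_cube)
  show "ennreal (\<delta> ^ CARD('n)) \<le> emeasure lborel (grid_cell \<delta> k)"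
    using emeasure_mono[OF box_subset_grid_cell[OF \<delta>, of k], of lborel] \<delta>
    by (simp add: emeasure_lborel_cube)
qed

lemma grid_cell_diff_mem_open_cube:
  assumes "0 < \<delta>" "x \<in> grid_cell \<delta> k" "z \<in> grid_cell \<delta> k"
  shows "x - z \<in> open_cube \<delta>"
proof -
  have "\<bar>x $ i - z $ i\<bar> < \<delta>" for i
  proof -
    have "\<lfloor>x $ i / \<delta>\<rfloor> = \<lfloor>z $ i / \<delta>\<rfloor>" using assms by (simp add: grid_cell_def)
    then have "\<bar>x $ i / \<delta> - z $ i / \<delta>\<bar> < 1" by linarith
    then show ?thesis using assms(1) by (simp add: abs_divide field_simps flip: diff_divide_distrib)
  qed
  then show ?thesis by (simp add: mem_open_cube_iff)
qed

lemma disjoint_grid_cells: "disjoint_family_on (grid_cell \<delta>) I"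
  by (auto simp: disjoint_family_on_def grid_cell_def)

text \<open>Cells are disjoint, so at most one summand is 1, and then x - z is a difference within
  one cell. This replaces a sum over cells by one condition on the shift.\<close>

lemma sum_indicator_grid_cell_le:
  fixes x z :: "real ^ 'n"
  assumes "0 < \<delta>" "finite I"
  shows "(\<Sum>k\<in>I. indicator (grid_cell \<delta> k) x * indicator (grid_cell \<delta> k) z)
    \<le> (indicator (open_cube \<delta>) (x - z) :: ennreal)"
proof (cases "\<exists>k\<in>I. x \<in> grid_cell \<delta> k \<and> z \<in> grid_cell \<delta> k")
  case True
  then obtain k where k: "k \<in> I" "x \<in> grid_cell \<delta> k" "z \<in> grid_cell \<delta> k" by blast
  have "(\<Sum>j\<in>I. indicator (grid_cell \<delta> j) x * indicator (grid_cell \<delta> j) z :: ennreal)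
      = (\<Sum>j\<in>I. if j = k then 1 else 0)"
    using k by (intro sum.cong) (auto simp: indicator_def grid_cell_def)
  also have "\<dots> = 1" using k assms by simp
  finally show ?thesis using grid_cell_diff_mem_open_cube[OF assms(1) k(2,3)] by simp
next
  case False
  then have "(\<Sum>k\<in>I. indicator (grid_cell \<delta> k) x * indicator (grid_cell \<delta> k) z :: ennreal) = 0"
    by (intro sum.neutral) (auto simp: indicator_def)
  then show ?thesis by simp
qed

text \<open>If \<open>a\<close> exceeded its mean everywhere on A, integrating this strict
  inequality over a set of positive measure would contradict the definition of the mean. The product
  form also covers an infinite integral.\<close>

lemma exists_le_average:
  fixes a :: "'a \<Rightarrow> ennreal"
  assumes [measurable]: "a \<in> borel_measurable M" "A \<in> sets M"
    and A: "emeasure M A \<noteq> 0" "emeasure M A < \<infinity>"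
  shows "\<exists>z\<in>A. a z * emeasure M A \<le> (\<integral>\<^sup>+z\<in>A. a z \<partial>M)"
proof (rule ccontr)
  assume "\<not> ?thesis"
  then have *: "(\<integral>\<^sup>+z\<in>A. a z \<partial>M) < a z * emeasure M A" if "z \<in> A" for z
    using that by (auto simp: not_le)
  obtain z0 where z0: "z0 \<in> A" using A(1) by fastforce
  define c where "c = (\<integral>\<^sup>+z\<in>A. a z \<partial>M) / emeasure M A"
  \<comment> \<open>The negated claim puts some value strictly above the integral, so the integral
    is finite, as a strict comparison of integrals requires.\<close>
  have fin: "(\<integral>\<^sup>+z\<in>A. a z \<partial>M) \<noteq> \<infinity>" using *[OF z0] by auto
  have c: "c * emeasure M A = (\<integral>\<^sup>+z\<in>A. a z \<partial>M)"
    using A by (simp add: c_def ennreal_divide_times ennreal_times_divide ennreal_mult_divide_eq flip: ennreal_times_divide)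
  have lt: "c < a z" if "z \<in> A" for z
    using *[OF that] c by (metis mult_right_mono not_le zero_le)
  have "(\<integral>\<^sup>+z. c * indicator A z \<partial>M) < (\<integral>\<^sup>+z. a z * indicator A z \<partial>M)"
  proof (rule nn_integral_less)
    show "(\<integral>\<^sup>+z. c * indicator A z \<partial>M) \<noteq> \<infinity>"
      using fin c by (simp add: nn_integral_cmult)
    show "AE z in M. c * indicator A z \<le> a z * indicator A z"
      using lt by (auto simp: indicator_def intro: less_imp_le)
    show "\<not> (AE z in M. a z * indicator A z \<le> c * indicator A z)"
    proof
      assume "AE z in M. a z * indicator A z \<le> c * indicator A z"
      then have "AE z in M. z \<notin> A"
        by (rule AE_mp) (use lt in \<open>auto simp: indicator_def not_le[symmetric]\<close>)
      then have "A \<in> null_sets M" by (simp add: AE_iff_null_sets)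
      with A show False by auto
    qed
  qed auto
  with c show False by (simp add: nn_integral_cmult)
qed

text \<open>The constant is the volume \<open>(2 * \<delta>) ^ CARD('n)\<close> of the shifts
  divided by the volume \<open>\<delta> ^ CARD('n)\<close> of a cell. It does not depend on I, so
  arbitrarily many cells can be used at the same cost.\<close>

lemma exists_step_approximation_borel:
  fixes f :: "real ^ 'n \<Rightarrow> 'b::euclidean_space" and w :: "real ^ 'n \<Rightarrow> ennreal"
  assumes [measurable]: "f \<in> borel_measurable borel" "w \<in> borel_measurable borel"
    and \<delta>: "0 < \<delta>" and I: "finite I"
    and shift: "\<And>y. y \<in> open_cube \<delta> \<Longrightarrow>
      (\<integral>\<^sup>+x. ennreal (norm (f (x - y) - f x) powr p) * w x \<partial>lborel) \<le> \<epsilon>"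
  shows "\<exists>c. (\<Sum>k\<in>I. \<integral>\<^sup>+x. ennreal (norm (f x - c k) powr p) * w x * indicator (grid_cell \<delta> k) x \<partial>lborel)
    \<le> 2 ^ CARD('n) * \<epsilon>"
proof -
  let ?Q = "grid_cell \<delta> :: ('n \<Rightarrow> int) \<Rightarrow> (real ^ 'n) set"
  let ?V = "open_cube \<delta> :: (real ^ 'n) set"
  have V[measurable]: "?V \<in> sets borel" by (simp add: open_cube_def)
  \<comment> \<open>The weight is attached to x and z is the averaging variable; after substituting
    z = x - y only f is translated.\<close>
  define G where "G x z = ennreal (norm (f z - f x) powr p) * w x" for x z
  have [measurable]: "case_prod G \<in> borel_measurable (borel \<Otimes>\<^sub>M borel)"
    unfolding G_def by measurable
  define a where "a k z = (\<integral>\<^sup>+x. G x z * indicator (?Q k) x \<partial>lborel)" for k z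
  have [measurable]: "a k \<in> borel_measurable borel" for k
    unfolding a_def by measurable
  define S where "S k = (\<integral>\<^sup>+z. a k z * indicator (?Q k) z \<partial>lborel)" for k
  have "(\<Sum>k\<in>I. S k) = (\<integral>\<^sup>+z. \<integral>\<^sup>+x. (\<Sum>k\<in>I. G x z * (indicator (?Q k) x * indicator (?Q k) z)) \<partial>lborel \<partial>lborel)"
    unfolding S_def a_def
    by (simp add: nn_integral_sum flip: nn_integral_multc mult.assoc)
  \<comment> \<open>Here the cells are forgotten: pairs in a common cell are enlarged to all pairs
    whose difference lies in the cube.\<close>
  also have "\<dots> \<le> (\<integral>\<^sup>+z. \<integral>\<^sup>+x. G x z * indicator ?V (x - z) \<partial>lborel \<partial>lborel)"
    unfolding sum_distrib_left[symmetric]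
    by (intro nn_integral_mono mult_left_mono sum_indicator_grid_cell_le \<delta> I) auto
  also have "\<dots> = (\<integral>\<^sup>+x. \<integral>\<^sup>+z. G x z * indicator ?V (x - z) \<partial>lborel \<partial>lborel)"
    by (rule lborel_pair.Fubini') measurable
  also have "\<dots> = (\<integral>\<^sup>+x. \<integral>\<^sup>+y. G x (x - y) * indicator ?V y \<partial>lborel \<partial>lborel)"
  proof (rule nn_integral_cong)
    fix x
    show "(\<integral>\<^sup>+z. G x z * indicator ?V (x - z) \<partial>lborel) = (\<integral>\<^sup>+y. G x (x - y) * indicator ?V y \<partial>lborel)"
      using nn_integral_lborel_reflect[of "\<lambda>z. G x z * indicator ?V (x - z)" x] by simp
  qed
  also have "\<dots> = (\<integral>\<^sup>+y. \<integral>\<^sup>+x. G x (x - y) * indicator ?V y \<partial>lborel \<partial>lborel)"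
    by (rule lborel_pair.Fubini'[symmetric]) measurable
  also have "\<dots> = (\<integral>\<^sup>+y. (\<integral>\<^sup>+x. G x (x - y) \<partial>lborel) * indicator ?V y \<partial>lborel)"
    by (simp add: nn_integral_multc)
  also have "\<dots> \<le> (\<integral>\<^sup>+y. \<epsilon> * indicator ?V y \<partial>lborel)"
    using shift by (intro nn_integral_mono) (auto simp: indicator_def G_def)
  also have "\<dots> = \<epsilon> * ennreal ((2 * \<delta>) ^ CARD('n))"
    using \<delta> by (simp add: nn_integral_cmult emeasure_open_cube)
  finally have S: "(\<Sum>k\<in>I. S k) \<le> \<epsilon> * ennreal ((2 * \<delta>) ^ CARD('n))" .
  have "\<forall>k. \<exists>z\<in>?Q k. a k z * ennreal (\<delta> ^ CARD('n)) \<le> S k"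
    using exists_le_average[of "a k" lborel "?Q k" for k] \<delta>
    by (auto simp: S_def emeasure_grid_cell)
  then obtain z where z: "\<And>k. a k (z k) * ennreal (\<delta> ^ CARD('n)) \<le> S k" by metis
  have "ennreal (\<delta> ^ CARD('n)) * (\<Sum>k\<in>I. a k (z k)) \<le> (\<Sum>k\<in>I. S k)"
    unfolding sum_distrib_left by (intro sum_mono) (use z in \<open>simp add: mult.commute\<close>)
  also have "\<dots> \<le> ennreal (\<delta> ^ CARD('n)) * (2 ^ CARD('n) * \<epsilon>)"
    using S \<delta> by (simp add: power_mult_distrib ennreal_mult' mult_ac flip: ennreal_power)
  finally have "(\<Sum>k\<in>I. a k (z k)) \<le> 2 ^ CARD('n) * \<epsilon>"
    using \<delta> by (subst (asm) ennreal_mult_le_mult_iff) auto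
  \<comment> \<open>The coefficient on cell k is the value of f at the point whose error is at most
    the mean over that cell.\<close>
  then show ?thesis
    unfolding a_def G_def by (intro exI[of _ "\<lambda>k. f (z k)"]) (simp add: norm_minus_commute)
qed

text \<open>The passage from Lebesgue measurable weight and function to representatives over
  \<open>lborel\<close>, where Tonelli is available.\<close>

lemma Lp_mod_density_lebesgue:
  fixes h :: "'a::euclidean_space \<Rightarrow> 'b::{real_normed_vector, second_countable_topology}"
  assumes [measurable]: "\<omega> \<in> borel_measurable lebesgue" "h \<in> borel_measurable lebesgue"
    and "AE x in lborel. \<omega> x = w x" "AE x in lborel. h x = g x"
  shows "Lp_mod p (density lebesgue \<omega>) h = (\<integral>\<^sup>+x. ennreal (norm (g x) powr p) * w x \<partial>lborel)"
proof -
  have "Lp_mod p (density lebesgue \<omega>) h = (\<integral>\<^sup>+x. \<omega> x * ennreal (norm (h x) powr p) \<partial>lborel)"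
    unfolding Lp_mod_def by (subst nn_integral_density) (simp_all add: nn_integral_completion)
  also have "\<dots> = (\<integral>\<^sup>+x. ennreal (norm (g x) powr p) * w x \<partial>lborel)"
    using assms(3,4) by (intro nn_integral_cong_AE) (auto simp: mult.commute)
  finally show ?thesis .
qed

subsection \<open>Finite nets\<close>

definition step_function :: "('k \<Rightarrow> 'a set) \<Rightarrow> 'k set \<Rightarrow> ('k \<Rightarrow> 'b::real_vector) \<Rightarrow> 'a \<Rightarrow> 'b" where
  "step_function A I c x = (\<Sum>k\<in>I. indicator (A k) x *\<^sub>R c k)"

lemma step_function_eq:
  assumes "finite I" "disjoint_family_on A I" "k \<in> I" "x \<in> A k"
  shows "step_function A I c x = c k"
proof -
  have "step_function A I c x = (\<Sum>j\<in>I. if j = k then c j else 0)"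
    unfolding step_function_def
    using assms by (intro sum.cong) (auto simp: indicator_def disjoint_family_on_def)
  with assms show ?thesis by simp
qed

lemma step_function_eq_0: "x \<notin> (\<Union>k\<in>I. A k) \<Longrightarrow> step_function A I c x = 0"
  unfolding step_function_def by (intro sum.neutral) (auto simp: indicator_def)

lemma borel_measurable_step_function[measurable]:
  fixes c :: "'k \<Rightarrow> 'b::{second_countable_topology, real_normed_vector}"
  assumes "\<And>k. k \<in> I \<Longrightarrow> A k \<in> sets M"
  shows "step_function A I c \<in> borel_measurable M"
  unfolding step_function_def using assms by (intro borel_measurable_sum) auto

lemma Lp_mod_step_function_diff_le:
  fixes c d :: "'k \<Rightarrow> 'b::{second_countable_topology, real_normed_vector}"
  assumes I: "finite I" "disjoint_family_on A I" and A: "\<And>k. k \<in> I \<Longrightarrow> A k \<in> sets M"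
    and p: "0 < p" and t: "\<And>k. k \<in> I \<Longrightarrow> norm (c k - d k) \<le> t"
  shows "Lp_mod p M (\<lambda>x. step_function A I c x - step_function A I d x)
    \<le> ennreal (t powr p) * emeasure M (\<Union>k\<in>I. A k)"
proof -
  have "(\<Union>k\<in>I. A k) \<in> sets M" using I A by auto
  then have "ennreal (t powr p) * emeasure M (\<Union>k\<in>I. A k)
      = (\<integral>\<^sup>+x. ennreal (t powr p) * indicator (\<Union>k\<in>I. A k) x \<partial>M)"
    by (simp add: nn_integral_cmult)
  moreover have "Lp_mod p M (\<lambda>x. step_function A I c x - step_function A I d x) \<le> \<dots>"
    unfolding Lp_mod_def
  proof (rule nn_integral_mono)
    fix x
    show "ennreal (norm (step_function A I c x - step_function A I d x) powr p)
      \<le> ennreal (t powr p) * indicator (\<Union>k\<in>I. A k) x"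
    proof (cases "x \<in> (\<Union>k\<in>I. A k)")
      case True
      then obtain k where "k \<in> I" "x \<in> A k" by blast
      then show ?thesis
        using True t[of k] p by (auto simp: step_function_eq[OF I] intro!: ennreal_leI powr_mono2)
    next
      case False
      then show ?thesis by (simp add: step_function_eq_0)
    qed
  qed
  ultimately show ?thesis by simp
qed

text \<open>On \<open>A k\<close> the step function is the constant \<open>c k\<close>, so this cell
  alone contributes \<open>norm (c k) powr p\<close> times its measure to an integral of at most B.
  Positive measure of the cell is what allows the division.\<close>

lemma coefficient_bound_of_Lp_mod_step_function:
  fixes c :: "'k \<Rightarrow> 'b::{second_countable_topology, real_normed_vector}"
  assumes I: "finite I" "disjoint_family_on A I" and k: "k \<in> I" and A: "A k \<in> sets M"
    "0 < emeasure M (A k)" "emeasure M (A k) < \<infinity>"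
    and p: "0 < p" and B: "Lp_mod p M (step_function A I c) \<le> ennreal B" "0 \<le> B"
  shows "norm (c k) \<le> (B / measure M (A k)) powr (1 / p)"
proof -
  have em: "emeasure M (A k) = ennreal (measure M (A k))"
    using A by (simp add: emeasure_eq_ennreal_measure)
  then have pos: "0 < measure M (A k)" using A(2) by simp
  have "ennreal (norm (c k) powr p) * emeasure M (A k) = (\<integral>\<^sup>+x. ennreal (norm (c k) powr p) * indicator (A k) x \<partial>M)"
    using A by (simp add: nn_integral_cmult)
  also have "\<dots> \<le> Lp_mod p M (step_function A I c)"
    unfolding Lp_mod_def
    using k by (intro nn_integral_mono) (auto simp: indicator_def step_function_eq[OF I])
  also have "\<dots> \<le> ennreal B" by (fact B)
  finally have "norm (c k) powr p * measure M (A k) \<le> B"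
    using B(2) by (simp add: em flip: ennreal_mult')
  then have "norm (c k) powr p \<le> B / measure M (A k)"
    using pos by (simp add: field_simps)
  then have "(norm (c k) powr p) powr (1 / p) \<le> (B / measure M (A k)) powr (1 / p)"
    using p by (intro powr_mono2) auto
  then show ?thesis using p by (simp add: powr_powr)
qed

text \<open>A pigeonhole argument: each f is recorded by nearby centres of its coefficients, taken
  from finite t/2-nets of balls. Only finitely many records occur, one f is kept for each, and
  functions with equal records have coefficients within t. The net thus stays inside F.\<close>

lemma finite_net_of_bounded_coefficients:
  fixes c :: "'f \<Rightarrow> 'k \<Rightarrow> 'b::euclidean_space"
  assumes I: "finite I" and t: "0 < t" and R: "\<And>f k. f \<in> F \<Longrightarrow> k \<in> I \<Longrightarrow> norm (c f k) \<le> R k"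
  shows "\<exists>K. finite K \<and> K \<subseteq> F \<and> (\<forall>f\<in>F. \<exists>g\<in>K. \<forall>k\<in>I. norm (c f k - c g k) \<le> t)"
proof -
  have "\<exists>Z. finite Z \<and> cball (0::'b) (R k) \<subseteq> (\<Union>z\<in>Z. ball z (t / 2))" for k :: 'k
    using compact_imp_seq_compact[OF compact_cball, THEN seq_compact_imp_totally_bounded, of 0 "R k",
        rule_format, of "t / 2"] t by auto
  then obtain Z where Z: "\<And>k. finite (Z k)" "\<And>k. cball (0::'b) (R k) \<subseteq> (\<Union>z\<in>Z k. ball z (t / 2))"
    by metis
  have "\<forall>f\<in>F. \<forall>k\<in>I. \<exists>z\<in>Z k. dist z (c f k) < t / 2"
  proof (intro ballI)
    fix f k assume "f \<in> F" "k \<in> I"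
    then have "c f k \<in> cball 0 (R k)" using R by simp
    from subsetD[OF Z(2) this] show "\<exists>z\<in>Z k. dist z (c f k) < t / 2" by auto
  qed
  then obtain z where z: "\<And>f k. f \<in> F \<Longrightarrow> k \<in> I \<Longrightarrow> z f k \<in> Z k \<and> dist (z f k) (c f k) < t / 2"
    by metis
  \<comment> \<open>Restricting to I places the records in an extensional product of finite sets,
    which is finite.\<close>
  define \<phi> where "\<phi> f = restrict (z f) I" for f
  have "\<phi> ` F \<subseteq> (\<Pi>\<^sub>E k\<in>I. Z k)" using z by (auto simp: \<phi>_def)
  then have "finite (\<phi> ` F)" by (rule finite_subset) (intro finite_PiE I Z(1))
  from finite_subset_image[OF this order_refl] obtain K where K: "K \<subseteq> F" "finite K" "\<phi> ` F = \<phi> ` K"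
    by (elim exE conjE)
  have "\<exists>g\<in>K. \<forall>k\<in>I. norm (c f k - c g k) \<le> t" if f: "f \<in> F" for f
  proof -
    obtain g where g: "g \<in> K" "\<phi> f = \<phi> g" using f K by blast
    have "norm (c f k - c g k) \<le> t" if k: "k \<in> I" for k
    proof -
      have "z f k = z g k" using g(2) k unfolding \<phi>_def by (metis restrict_apply')
      moreover have "dist (z f k) (c f k) < t / 2" "dist (z g k) (c g k) < t / 2"
        using z f g K k by blast+
      ultimately have "dist (c f k) (c g k) < t" by (metis dist_commute dist_triangle_half_l)
      then show ?thesis by (simp add: dist_norm)
    qed
    with g show ?thesis by blast
  qed
  with K show ?thesis by blast
qed

text \<open>The final constant comes from two uses of the inequality with factor
  \<open>2 powr p\<close> on f - g = (f - s_f) + ((s_f - s_g) + (s_g - g)), where s_f and s_g are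
  the step functions and each of the three terms costs \<eta>.\<close>

lemma finite_net_of_step_approximation:
  fixes F :: "('a \<Rightarrow> 'b::euclidean_space) set"
  assumes I: "finite I" "disjoint_family_on A I" and A: "\<And>k. k \<in> I \<Longrightarrow> A k \<in> sets M"
    "\<And>k. k \<in> I \<Longrightarrow> 0 < emeasure M (A k)" "\<And>k. k \<in> I \<Longrightarrow> emeasure M (A k) < \<infinity>"
    and p: "0 < p" and F: "\<And>f. f \<in> F \<Longrightarrow> f \<in> borel_measurable M"
    "\<And>f. f \<in> F \<Longrightarrow> Lp_mod p M f \<le> ennreal B" and B: "0 \<le> B" and \<eta>: "0 < \<eta>"
    and step: "\<And>f. f \<in> F \<Longrightarrow> \<exists>c. Lp_mod p M (\<lambda>x. f x - step_function A I c x) \<le> ennreal \<eta>"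
  shows "\<exists>K. finite K \<and> K \<subseteq> F \<and>
    (\<forall>f\<in>F. \<exists>g\<in>K. Lp_mod p M (\<lambda>x. f x - g x) \<le> ennreal (2 powr p * (\<eta> + 2 powr p * (\<eta> + \<eta>))))"
proof -
  obtain c where c: "\<And>f. f \<in> F \<Longrightarrow> Lp_mod p M (\<lambda>x. f x - step_function A I (c f) x) \<le> ennreal \<eta>"
    using step by metis
  have meas: "step_function A I d \<in> borel_measurable M" for d :: "'c \<Rightarrow> 'b"
    using A(1) by (rule borel_measurable_step_function)
  have add: "Lp_mod p M (\<lambda>x. g x + h x) \<le> ennreal (2 powr p * (a + b))"
    if "g \<in> borel_measurable M" "h \<in> borel_measurable M" "Lp_mod p M g \<le> ennreal a"
      "Lp_mod p M h \<le> ennreal b" "0 \<le> a" "0 \<le> b" for g h :: "'a \<Rightarrow> 'b" and a b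
  proof -
    have "Lp_mod p M (\<lambda>x. g x + h x) \<le> ennreal (2 powr p) * (Lp_mod p M g + Lp_mod p M h)"
      using that by (intro Lp_mod_add_le_two_powr p)
    also have "\<dots> \<le> ennreal (2 powr p) * (ennreal a + ennreal b)"
      using that by (intro mult_left_mono add_mono) auto
    finally show ?thesis using that by (simp add: ennreal_mult')
  qed
  \<comment> \<open>Boundedness passes from f to its step function through the splitting (s_f - f) +
    f.\<close>
  define B' where "B' = 2 powr p * (\<eta> + B)"
  have "Lp_mod p M (step_function A I (c f)) \<le> ennreal B'" if f: "f \<in> F" for f
  proof -
    have "Lp_mod p M (\<lambda>x. (step_function A I (c f) x - f x) + f x) \<le> ennreal B'"
      unfolding B'_def
    proof (rule add)
      show "Lp_mod p M (\<lambda>x. step_function A I (c f) x - f x) \<le> ennreal \<eta>"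
        using c[OF f] by (subst Lp_mod_diff_commute)
    qed (use f F meas B \<eta> in auto)
    then show ?thesis by simp
  qed
  then have bound: "norm (c f k) \<le> (B' / measure M (A k)) powr (1 / p)" if "f \<in> F" "k \<in> I" for f k
    using that A B \<eta> p
    by (intro coefficient_bound_of_Lp_mod_step_function[OF I]) (auto simp: B'_def)
  define \<mu> where "\<mu> = measure M (\<Union>k\<in>I. A k)"
  have "emeasure M (\<Union>k\<in>I. A k) \<le> (\<Sum>k\<in>I. emeasure M (A k))"
    using I A by (intro emeasure_subadditive_finite) auto
  also have "\<dots> < \<infinity>" using I A(3) by (simp add: ennreal_sum_less_top less_top)
  finally have \<mu>: "emeasure M (\<Union>k\<in>I. A k) = ennreal \<mu>"
    unfolding \<mu>_def by (simp add: emeasure_eq_ennreal_measure)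
  have \<mu>0: "0 \<le> \<mu>" by (simp add: \<mu>_def)
  \<comment> \<open>Chosen so that \<open>t powr p * \<mu>\<close> equals
    \<open>\<eta> * (\<mu> / (\<mu> + 1))\<close>, at most \<eta>; adding 1 keeps the quotient
    meaningful when I is empty and \<mu> = 0.\<close>
  define t where "t = (\<eta> / (\<mu> + 1)) powr (1 / p)"
  have t: "0 < t" using \<eta> \<mu>0 by (simp add: t_def)
  have "\<exists>K. finite K \<and> K \<subseteq> F \<and> (\<forall>f\<in>F. \<exists>g\<in>K. \<forall>k\<in>I. norm (c f k - c g k) \<le> t)"
    by (rule finite_net_of_bounded_coefficients[OF I(1) t]) (rule bound)
  then obtain K where K: "finite K" "K \<subseteq> F" "\<And>f. f \<in> F \<Longrightarrow> \<exists>g\<in>K. \<forall>k\<in>I. norm (c f k - c g k) \<le> t"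
    by auto
  have "\<exists>g\<in>K. Lp_mod p M (\<lambda>x. f x - g x) \<le> ennreal (2 powr p * (\<eta> + 2 powr p * (\<eta> + \<eta>)))"
    if f: "f \<in> F" for f
  proof -
    obtain g where g: "g \<in> K" "\<And>k. k \<in> I \<Longrightarrow> norm (c f k - c g k) \<le> t" using K(3)[OF f] by blast
    then have gF: "g \<in> F" using K by blast
    let ?s = "\<lambda>h. step_function A I (c h)"
    have "Lp_mod p M (\<lambda>x. ?s f x - ?s g x) \<le> ennreal (t powr p) * ennreal \<mu>"
      using Lp_mod_step_function_diff_le[OF I A(1) p g(2)] by (simp add: \<mu>)
    also have "\<dots> = ennreal (\<eta> * (\<mu> / (\<mu> + 1)))"
      using \<eta> \<mu>0 p by (simp add: t_def powr_powr flip: ennreal_mult')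
    also have "\<dots> \<le> ennreal \<eta>"
      using \<eta> \<mu>0 by (intro ennreal_leI mult_left_le) auto
    finally have mid: "Lp_mod p M (\<lambda>x. ?s f x - ?s g x) \<le> ennreal \<eta>" .
    have last: "Lp_mod p M (\<lambda>x. ?s g x - g x) \<le> ennreal \<eta>"
      using c[OF gF] by (subst Lp_mod_diff_commute)
    have "Lp_mod p M (\<lambda>x. (?s f x - ?s g x) + (?s g x - g x)) \<le> ennreal (2 powr p * (\<eta> + \<eta>))"
      using mid last F f gF meas \<eta> by (intro add[of "\<lambda>x. ?s f x - ?s g x"]) auto
    then have "Lp_mod p M (\<lambda>x. (f x - ?s f x) + ((?s f x - ?s g x) + (?s g x - g x)))
        \<le> ennreal (2 powr p * (\<eta> + 2 powr p * (\<eta> + \<eta>)))"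
      using c[OF f] F f gF meas \<eta> by (intro add[of "\<lambda>x. f x - ?s f x"]) auto
    then have "Lp_mod p M (\<lambda>x. f x - g x) \<le> ennreal (2 powr p * (\<eta> + 2 powr p * (\<eta> + \<eta>)))"
      by simp
    then show ?thesis using g(1) by (rule bexI)
  qed
  with K(1,2) show ?thesis by (intro exI conjI ballI)
qed

text \<open>Transfers the Borel estimate to Lebesgue measurable f and \<omega> and adds the part of
  space that the finitely many cells leave uncovered.\<close>

lemma exists_grid_step_approximation:
  fixes f :: "real ^ 'n \<Rightarrow> 'b::euclidean_space"
  assumes \<omega>: "\<omega> \<in> borel_measurable lebesgue" and f: "f \<in> borel_measurable lebesgue"
    and \<delta>: "0 < \<delta>" and I: "finite I"
    and shift: "\<And>y. y \<in> open_cube \<delta> \<Longrightarrow> Lp_mod p (density lebesgue \<omega>) (\<lambda>x. f (x - y) - f x) \<le> \<epsilon>"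
  shows "\<exists>c. Lp_mod p (density lebesgue \<omega>) (\<lambda>x. f x - step_function (grid_cell \<delta>) I c x)
    \<le> 2 ^ CARD('n) * \<epsilon> +
      Lp_mod p (density lebesgue \<omega>) (\<lambda>x. indicator (- (\<Union>k\<in>I. grid_cell \<delta> k)) x *\<^sub>R f x)"
proof -
  let ?Q = "grid_cell \<delta> :: ('n \<Rightarrow> int) \<Rightarrow> (real ^ 'n) set"
  let ?R = "\<Union>k\<in>I. ?Q k"
  obtain g where g[measurable]: "g \<in> borel_measurable borel" and fg: "AE x in lborel. f x = g x"
    using completion_ex_borel_measurable_euclidean[OF f] by auto
  obtain w where w[measurable]: "w \<in> borel_measurable borel" and \<omega>w: "AE x in lborel. \<omega> x = w x"
    using completion_ex_borel_measurable[OF \<omega>] by auto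
  \<comment> \<open>Translation invariance keeps g equal to f a.e. after a shift, and Lebesgue null
    sets are null for the weighted measure, so the hypothesis on f carries over to g.\<close>
  have shift': "(\<integral>\<^sup>+x. ennreal (norm (g (x - y) - g x) powr p) * w x \<partial>lborel) \<le> \<epsilon>"
    if y: "y \<in> open_cube \<delta>" for y
  proof -
    have ae: "AE x in lborel. f (x - y) - f x = g (x - y) - g x"
      using fg AE_lborel_translate[OF fg, of y] by auto
    have "(\<lambda>x. g (x - y) - g x) \<in> borel_measurable lebesgue"
      by (rule measurable_completion) measurable
    then have "(\<integral>\<^sup>+x. ennreal (norm (g (x - y) - g x) powr p) * w x \<partial>lborel)
        = Lp_mod p (density lebesgue \<omega>) (\<lambda>x. g (x - y) - g x)"
      by (intro Lp_mod_density_lebesgue[symmetric] \<omega> \<omega>w) auto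
    also have "\<dots> = Lp_mod p (density lebesgue \<omega>) (\<lambda>x. f (x - y) - f x)"
      using AE_completion[OF ae] by (intro Lp_mod_cong_AE) (auto simp: AE_density[OF \<omega>])
    finally show ?thesis using shift[OF y] by simp
  qed
  obtain c where c: "(\<Sum>k\<in>I. \<integral>\<^sup>+x. ennreal (norm (g x - c k) powr p) * w x * indicator (?Q k) x \<partial>lborel)
      \<le> 2 ^ CARD('n) * \<epsilon>"
    using exists_step_approximation_borel[OF g w \<delta> I shift'] by blast
  let ?s = "step_function ?Q I c"
  have [measurable]: "?s \<in> borel_measurable borel"
    by (rule borel_measurable_step_function) simp
  have R[measurable]: "?R \<in> sets borel" using I by auto
  have s: "?s \<in> borel_measurable lebesgue" and R': "?R \<in> sets lebesgue"
    by (auto intro: measurable_completion)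
  have "Lp_mod p (density lebesgue \<omega>) (\<lambda>x. f x - ?s x)
      = (\<integral>\<^sup>+x. ennreal (norm (g x - ?s x) powr p) * w x \<partial>lborel)"
    using fg f s by (intro Lp_mod_density_lebesgue \<omega> \<omega>w) auto
  \<comment> \<open>On a cell of the family the step function is the coefficient of that cell, by
    disjointness; off all of them it is 0 and the error is g itself.\<close>
  also have "\<dots> \<le> (\<integral>\<^sup>+x. (\<Sum>k\<in>I. ennreal (norm (g x - c k) powr p) * w x * indicator (?Q k) x)
      + ennreal (norm (indicator (- ?R) x *\<^sub>R g x) powr p) * w x \<partial>lborel)"
  proof (rule nn_integral_mono)
    fix x
    let ?h = "\<lambda>k. ennreal (norm (g x - c k) powr p) * w x * indicator (?Q k) x"
    show "ennreal (norm (g x - ?s x) powr p) * w x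
      \<le> (\<Sum>k\<in>I. ?h k) + ennreal (norm (indicator (- ?R) x *\<^sub>R g x) powr p) * w x"
    proof (cases "x \<in> ?R")
      case True
      then obtain k where k: "k \<in> I" "x \<in> ?Q k" by blast
      have "ennreal (norm (g x - ?s x) powr p) * w x = ?h k"
        using k step_function_eq[where A = ?Q, OF I disjoint_grid_cells k, of c] by simp
      also have "\<dots> \<le> (\<Sum>k\<in>I. ?h k)" using I k by (intro member_le_sum) auto
      finally show ?thesis by (rule order_trans) simp
    next
      case False
      then show ?thesis by (simp add: step_function_eq_0)
    qed
  qed
  also have "\<dots> = (\<Sum>k\<in>I. \<integral>\<^sup>+x. ennreal (norm (g x - c k) powr p) * w x * indicator (?Q k) x \<partial>lborel)
      + (\<integral>\<^sup>+x. ennreal (norm (indicator (- ?R) x *\<^sub>R g x) powr p) * w x \<partial>lborel)"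
    by (simp add: nn_integral_add nn_integral_sum)
  also have "(\<integral>\<^sup>+x. ennreal (norm (indicator (- ?R) x *\<^sub>R g x) powr p) * w x \<partial>lborel)
      = Lp_mod p (density lebesgue \<omega>) (\<lambda>x. indicator (- ?R) x *\<^sub>R f x)"
  proof (rule Lp_mod_density_lebesgue[symmetric, OF \<omega> _ \<omega>w])
    have "- ?R \<in> sets lebesgue" using R' Compl_in_sets_lebesgue by blast
    with f show "(\<lambda>x. indicator (- ?R) x *\<^sub>R f x) \<in> borel_measurable lebesgue"
      by (intro borel_measurable_scaleR borel_measurable_indicator)
    show "AE x in lborel. indicator (- ?R) x *\<^sub>R f x = (indicator (- ?R) x *\<^sub>R g x)"
      using fg by auto
  qed
  finally show ?thesis
    using c by (intro exI[of _ c]) (auto intro: order_trans add_right_mono)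
qed

section \<open>Ingredients for choosing the grid from the three hypotheses\<close>

lemma measurable_lebesgue_translate:
  fixes f :: "'a::euclidean_space \<Rightarrow> 'b::topological_space"
  assumes "f \<in> borel_measurable lebesgue"
  shows "(\<lambda>x. f (x - y)) \<in> borel_measurable lebesgue"
proof -
  \<comment> \<open>The translation is written as an affine map with all scale factors 1, which
    preserves Lebesgue measurability.\<close>
  have "(\<lambda>x. - y + (\<Sum>j\<in>Basis. (1 * (x \<bullet> j)) *\<^sub>R j)) \<in> lebesgue \<rightarrow>\<^sub>M (lebesgue :: 'a measure)"
    by (rule lebesgue_affine_measurable) simp
  then have "(\<lambda>x. x - y) \<in> lebesgue \<rightarrow>\<^sub>M (lebesgue :: 'a measure)"
    by (simp add: euclidean_representation)
  from measurable_compose[OF this assms] show ?thesis .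
qed

lemma Lp_mod_le_of_Lp_norm_less:
  fixes h :: "real ^ 'n \<Rightarrow> 'b::{real_normed_field, euclidean_space}"
  assumes "weight \<omega>" "h \<in> borel_measurable lebesgue" "0 < p" "0 < e"
    and "Lp_norm p \<omega> h < ennreal (e powr (1 / p))"
  shows "Lp_mod p (density lebesgue \<omega>) h \<le> ennreal e"
  using assms ennreal_powr_less_iff[of p "e powr (1 / p)" "Lp_mod p (density lebesgue \<omega>) h"]
  by (simp add: Lp_norm_eq_Lp_mod weight_measurable powr_powr less_imp_le)

text \<open>Positivity comes from \<omega> > 0 a.e., since otherwise the cell would be Lebesgue
  null; finiteness comes from local integrability on the closed cube around the cell.\<close>

lemma emeasure_grid_cell_weight:
  fixes \<omega> :: "real ^ 'n \<Rightarrow> ennreal"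
  assumes \<omega>: "weight \<omega>" and \<delta>: "0 < \<delta>"
  shows "0 < emeasure (density lebesgue \<omega>) (grid_cell \<delta> k)"
    and "emeasure (density lebesgue \<omega>) (grid_cell \<delta> k) < \<infinity>"
proof -
  let ?M = "density lebesgue \<omega>"
  have [measurable]: "\<omega> \<in> borel_measurable lebesgue" using \<omega> by (rule weight_measurable)
  have Q: "grid_cell \<delta> k \<in> sets lebesgue" by auto
  have "emeasure ?M (grid_cell \<delta> k) \<noteq> 0"
  proof
    assume "emeasure ?M (grid_cell \<delta> k) = 0"
    then have "grid_cell \<delta> k \<in> null_sets ?M" using Q by (auto simp: null_sets_def)
    then have "AE x in ?M. x \<notin> grid_cell \<delta> k" by (rule AE_not_in)
    then have "AE x in lebesgue. x \<notin> grid_cell \<delta> k" by (simp add: AE_density_weight_iff[OF \<omega>])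
    then have "grid_cell \<delta> k \<in> null_sets lebesgue" using Q by (simp add: AE_iff_null_sets)
    then have "emeasure lborel (grid_cell \<delta> k) = 0" by (simp add: null_sets_def)
    then show False using \<delta> by (simp add: emeasure_grid_cell)
  qed
  then show "0 < emeasure ?M (grid_cell \<delta> k)" by (simp add: zero_less_iff_neq_zero)
  let ?C = "cbox (\<chi> i. of_int (k i) * \<delta>) (\<chi> i. of_int (k i) * \<delta> + \<delta>)"
  have "emeasure ?M (grid_cell \<delta> k) = (\<integral>\<^sup>+x\<in>grid_cell \<delta> k. \<omega> x \<partial>lebesgue)"
    using Q by (simp add: emeasure_density)
  also have "\<dots> \<le> (\<integral>\<^sup>+x\<in>?C. \<omega> x \<partial>lebesgue)"
    using grid_cell_subset_cbox[OF \<delta>, of k] by (intro nn_integral_mono) (auto simp: indicator_def)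
  also have "\<dots> < \<infinity>" using \<omega> unfolding weight_def by (blast intro: compact_cbox)
  finally show "emeasure ?M (grid_cell \<delta> k) < \<infinity>" .
qed

lemma exists_small_open_cube:
  assumes "0 < r"
  obtains \<delta> where "0 < \<delta>" "open_cube \<delta> \<subseteq> (ball 0 r :: (real ^ 'n) set)"
proof
  \<comment> \<open>The Euclidean norm is at most the sum of the n coordinates, hence at most n *
    \<delta>; dividing by n + 1 makes this strictly less than r.\<close>
  let ?\<delta> = "r / (real CARD('n) + 1)"
  show \<delta>: "0 < ?\<delta>" using assms by (simp add: add_nonneg_pos)
  show "open_cube ?\<delta> \<subseteq> (ball 0 r :: (real ^ 'n) set)"
  proof
    fix y :: "real ^ 'n" assume "y \<in> open_cube ?\<delta>"
    then have "(\<Sum>i\<in>UNIV. \<bar>y $ i\<bar>) \<le> (\<Sum>i\<in>(UNIV :: 'n set). ?\<delta>)"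
      by (intro sum_mono) (auto simp: mem_open_cube_iff less_imp_le)
    then have "norm y \<le> real CARD('n) * ?\<delta>"
      using norm_le_l1_cart[of y] by simp
    also have "\<dots> < (real CARD('n) + 1) * ?\<delta>"
      using \<delta> by (intro mult_strict_right_mono) auto
    also have "\<dots> = r" by simp
    finally show "y \<in> ball 0 r" by simp
  qed
qed

lemma ball_covered_by_finitely_many_grid_cells:
  assumes "0 < \<delta>"
  obtains I where "finite I" "ball 0 N \<subseteq> (\<Union>k\<in>I. grid_cell \<delta> k :: (real ^ 'n) set)"
proof
  let ?m = "\<lceil>\<bar>N\<bar> / \<delta>\<rceil> + 1"
  let ?I = "{k :: 'n \<Rightarrow> int. \<forall>i. k i \<in> {- ?m..?m}}"
  show "finite ?I"
    using finite_PiE[of "UNIV :: 'n set" "\<lambda>_. {- ?m..?m}"] by (simp add: PiE_UNIV_domain Pi_def)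
  show "ball 0 N \<subseteq> (\<Union>k\<in>?I. grid_cell \<delta> k :: (real ^ 'n) set)"
  proof
    fix x :: "real ^ 'n" assume x: "x \<in> ball 0 N"
    have "\<lfloor>x $ i / \<delta>\<rfloor> \<in> {- ?m..?m}" for i
    proof -
      have "\<bar>x $ i\<bar> \<le> \<bar>N\<bar>" using component_le_norm_cart[of x i] x by simp
      then have "\<bar>x $ i / \<delta>\<bar> \<le> \<bar>N\<bar> / \<delta>" using assms by (simp add: abs_divide divide_right_mono)
      then show ?thesis unfolding atLeastAtMost_iff by linarith
    qed
    then show "x \<in> (\<Union>k\<in>?I. grid_cell \<delta> k)"
      by (intro UN_I[of "\<lambda>i. \<lfloor>x $ i / \<delta>\<rfloor>"]) (auto simp: grid_cell_def)
  qed
qed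

theorem corollary3p8:
  fixes p :: real
    and \<omega> :: "real ^ 'n \<Rightarrow> ennreal"
    and F :: "(real ^ 'n \<Rightarrow> 'b::{real_normed_field, euclidean_space}) set"
  assumes "0 < p"
    and "weight \<omega>"
    and "F \<subseteq> Lp_functions p \<omega>"
    and bounded: "(SUP f\<in>F. Lp_norm p \<omega> f) < \<infinity>"
    and vanishing: "((\<lambda>N::real. SUP f\<in>F. Lp_norm p \<omega> (\<lambda>x. indicator (- ball 0 N) x * f x))
                      \<longlongrightarrow> 0) at_top"
    and equicontinuous: "((\<lambda>r::real. SUP f\<in>F. SUP y\<in>ball 0 r. Lp_norm p \<omega> (\<lambda>x. f (x - y) - f x))
                      \<longlongrightarrow> 0) (at_right 0)"
  shows "relatively_compact_in (Lp_topology p \<omega>) (ae_class ` F) \<and> Lp_totally_bounded p \<omega> F"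
proof (rule relatively_compact_Lp_if_finite_nets[OF assms(1-3)])
  note p = \<open>0 < p\<close> and \<omega> = \<open>weight \<omega>\<close>
  let ?M = "density lebesgue \<omega>"
  have meas: "f \<in> borel_measurable lebesgue" if "f \<in> F" for f
    using that assms(3) by (auto simp: Lp_functions_def)
  \<comment> \<open>Adding 1 makes B positive and every norm strictly smaller than B, the form in
    which norm bounds are turned into bounds on \<open>Lp_mod\<close>.\<close>
  define B where "B = enn2real (SUP f\<in>F. Lp_norm p \<omega> f) + 1"
  have B: "0 < B" by (simp add: B_def add_nonneg_pos)
  have bound: "Lp_mod p ?M f \<le> ennreal (B powr p)" if f: "f \<in> F" for f
  proof (rule Lp_mod_le_of_Lp_norm_less[OF \<omega> meas[OF f] p])
    have "Lp_norm p \<omega> f \<le> (SUP f\<in>F. Lp_norm p \<omega> f)" using f by (rule SUP_upper)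
    also have "\<dots> = ennreal (B - 1)" using bounded by (simp add: B_def)
    also have "\<dots> < ennreal B" using B by (intro ennreal_lessI) auto
    finally show "Lp_norm p \<omega> f < ennreal ((B powr p) powr (1 / p))" using p B by (simp add: powr_powr)
  qed (use B in auto)
  fix \<epsilon> :: real assume \<epsilon>: "0 < \<epsilon>"
  \<comment> \<open>D collects the constants of the net, whose accuracy is then
    \<open>D * \<eta>\<close>; \<eta> makes this \<epsilon> / 2 and so strictly below
    \<epsilon>.\<close>
  define D where "D = 2 powr p * (1 + 2 powr p * 2)"
  have D: "0 < D" by (simp add: D_def add_pos_pos)
  define \<eta> where "\<eta> = \<epsilon> / (2 * D)"
  have \<eta>: "0 < \<eta>" using \<epsilon> D by (simp add: \<eta>_def)
  \<comment> \<open>The grid multiplies the shift error by 2^n, so this value contributes \<eta> /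
    2; the other half is reserved for the tail outside \<open>ball 0 N\<close>.\<close>
  define e where "e = \<eta> / 2 / 2 ^ CARD('n)"
  have e: "0 < e" using \<eta> by (simp add: e_def)
  have "\<forall>\<^sub>F N in at_top. (SUP f\<in>F. Lp_norm p \<omega> (\<lambda>x. indicator (- ball 0 N) x * f x))
      < ennreal ((\<eta> / 2) powr (1 / p))"
    using vanishing \<eta> by (intro order_tendstoD(2)) auto
  then obtain N where N: "(SUP f\<in>F. Lp_norm p \<omega> (\<lambda>x. indicator (- ball 0 N) x * f x))
      < ennreal ((\<eta> / 2) powr (1 / p))"
    by (auto simp: eventually_at_top_linorder)
  have "\<forall>\<^sub>F r in at_right 0. (SUP f\<in>F. SUP y\<in>ball 0 r. Lp_norm p \<omega> (\<lambda>x. f (x - y) - f x))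
      < ennreal (e powr (1 / p))"
    using equicontinuous e by (intro order_tendstoD(2)) auto
  then obtain s where s: "0 < s" "\<And>r. 0 < r \<Longrightarrow> r < s \<Longrightarrow>
      (SUP f\<in>F. SUP y\<in>ball 0 r. Lp_norm p \<omega> (\<lambda>x. f (x - y) - f x)) < ennreal (e powr (1 / p))"
    by (auto simp: eventually_at_right_field)
  define r where "r = s / 2"
  have r: "0 < r" "(SUP f\<in>F. SUP y\<in>ball 0 r. Lp_norm p \<omega> (\<lambda>x. f (x - y) - f x)) < ennreal (e powr (1 / p))"
    using s(1) s(2)[of r] by (auto simp: r_def)
  obtain \<delta> where \<delta>: "0 < \<delta>" "open_cube \<delta> \<subseteq> (ball 0 r :: (real ^ 'n) set)"
    using exists_small_open_cube[OF r(1)] .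
  \<comment> \<open>N and \<delta> serve the whole family, so all its step functions live on the
    same finitely many cells and only their coefficients vary with f.\<close>
  obtain I where I: "finite I" "ball 0 N \<subseteq> (\<Union>k\<in>I. grid_cell \<delta> k :: (real ^ 'n) set)"
    using ball_covered_by_finitely_many_grid_cells[OF \<delta>(1)] .
  let ?R = "\<Union>k\<in>I. grid_cell \<delta> k :: (real ^ 'n) set"
  have step: "\<exists>c. Lp_mod p ?M (\<lambda>x. f x - step_function (grid_cell \<delta>) I c x) \<le> ennreal \<eta>" if f: "f \<in> F" for f
  proof -
    have shift: "Lp_mod p ?M (\<lambda>x. f (x - y) - f x) \<le> ennreal e" if y: "y \<in> open_cube \<delta>" for y
    proof (rule Lp_mod_le_of_Lp_norm_less[OF \<omega> _ p e])
      show "(\<lambda>x. f (x - y) - f x) \<in> borel_measurable lebesgue"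
        using meas[OF f] measurable_lebesgue_translate[OF meas[OF f]] by (rule borel_measurable_diff[rotated])
      have "Lp_norm p \<omega> (\<lambda>x. f (x - y) - f x)
          \<le> (SUP y\<in>ball 0 r. Lp_norm p \<omega> (\<lambda>x. f (x - y) - f x))"
        using y \<delta>(2) by (intro SUP_upper) auto
      also have "\<dots> \<le> (SUP f\<in>F. SUP y\<in>ball 0 r. Lp_norm p \<omega> (\<lambda>x. f (x - y) - f x))"
        using f by (rule SUP_upper)
      finally show "Lp_norm p \<omega> (\<lambda>x. f (x - y) - f x) < ennreal (e powr (1 / p))"
        using r(2) by (rule order_le_less_trans)
    qed
    \<comment> \<open>The cells cover \<open>ball 0 N\<close>, so what they miss lies in the region
      controlled by uniform vanishing.\<close>
    have "Lp_mod p ?M (\<lambda>x. indicator (- ?R) x *\<^sub>R f x)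
        \<le> Lp_mod p ?M (\<lambda>x. indicator (- ball 0 N) x * f x)"
      unfolding Lp_mod_def using I(2) p
      by (intro nn_integral_mono) (auto simp: indicator_def)
    also have "\<dots> \<le> ennreal (\<eta> / 2)"
    proof (rule Lp_mod_le_of_Lp_norm_less[OF \<omega> _ p])
      show "(\<lambda>x. indicator (- ball 0 N) x * f x) \<in> borel_measurable lebesgue"
        using meas[OF f] by (intro borel_measurable_times borel_measurable_indicator) auto
      have "Lp_norm p \<omega> (\<lambda>x. indicator (- ball 0 N) x * f x)
          \<le> (SUP f\<in>F. Lp_norm p \<omega> (\<lambda>x. indicator (- ball 0 N) x * f x))"
        using f by (rule SUP_upper)
      with N show "Lp_norm p \<omega> (\<lambda>x. indicator (- ball 0 N) x * f x) < ennreal ((\<eta> / 2) powr (1 / p))"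
        by (rule order_le_less_trans[rotated])
    qed (use \<eta> in simp)
    finally have tail: "Lp_mod p ?M (\<lambda>x. indicator (- ?R) x *\<^sub>R f x) \<le> ennreal (\<eta> / 2)" .
    obtain c where "Lp_mod p ?M (\<lambda>x. f x - step_function (grid_cell \<delta>) I c x)
        \<le> 2 ^ CARD('n) * ennreal e + Lp_mod p ?M (\<lambda>x. indicator (- ?R) x *\<^sub>R f x)"
      using exists_grid_step_approximation[OF weight_measurable[OF \<omega>] meas[OF f] \<delta>(1) I(1) shift] by blast
    also have "\<dots> \<le> ennreal (2 ^ CARD('n)) * ennreal e + ennreal (\<eta> / 2)"
      using tail by (intro add_mono) (simp_all flip: ennreal_power)
    also have "\<dots> = ennreal (2 ^ CARD('n) * e + \<eta> / 2)"
      using e \<eta> by (subst ennreal_mult'[symmetric]) auto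
    also have "2 ^ CARD('n) * e + \<eta> / 2 = \<eta>" by (simp add: e_def)
    finally show ?thesis by blast
  qed
  have "\<exists>K. finite K \<and> K \<subseteq> F \<and>
    (\<forall>f\<in>F. \<exists>g\<in>K. Lp_mod p ?M (\<lambda>x. f x - g x) \<le> ennreal (2 powr p * (\<eta> + 2 powr p * (\<eta> + \<eta>))))"
  proof (rule finite_net_of_step_approximation[OF I(1) disjoint_grid_cells _ _ _ p _ bound _ \<eta> step])
    show "grid_cell \<delta> k \<in> sets ?M" for k :: "'n \<Rightarrow> int" by auto
    show "f \<in> borel_measurable ?M" if "f \<in> F" for f using meas[OF that] by simp
  qed (use emeasure_grid_cell_weight[OF \<omega> \<delta>(1)] in auto)
  moreover have "ennreal (2 powr p * (\<eta> + 2 powr p * (\<eta> + \<eta>))) < ennreal \<epsilon>"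
  proof (rule ennreal_lessI[OF \<epsilon>])
    have "2 powr p * (\<eta> + 2 powr p * (\<eta> + \<eta>)) = D * \<eta>" by (simp add: D_def algebra_simps)
    also have "\<dots> = \<epsilon> / 2" using D by (simp add: \<eta>_def)
    finally show "2 powr p * (\<eta> + 2 powr p * (\<eta> + \<eta>)) < \<epsilon>" using \<epsilon> by simp
  qed
  ultimately show "\<exists>K. finite K \<and> K \<subseteq> F \<and> (\<forall>f\<in>F. \<exists>g\<in>K. Lp_mod p ?M (\<lambda>x. f x - g x) < ennreal \<epsilon>)"
    by (meson order_le_less_trans)
qed

end
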